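(* For $X\in c\mathrm{Aff}$ levelwise Noetherian, the canonical morphism $f:\hat X\to X$ is a weak equivalence.
   Context: $c\mathrm{Aff}$ is the category of cosimplicial affine schemes, i.e. the opposite of the category of simplicial commutative rings. Write $X=\mathrm{Spec}\,A$ with $A$ a simplicial ring, $X^n=\mathrm{Spec}\,A_n$; levelwise Noetherian means each $A_n$ is Noetherian. A morphism $\mathrm{Spec}\,B\to\mathrm{Spec}\,A$ in $c\mathrm{Aff}$ is a weak equivalence if $\pi_n(A)\cong\pi_n(B)$ for all $n$. $\hat X\in c\mathrm{Aff}$ is defined by $\hat X^n=\mathrm{Spec}\varprojlim_m A_n/(I_n)^m$, where $I_n=\ker(A_n\to\pi_0A)$. *)

theory Defs
  imports "HOL-Algebra.Algebra"
begin

section \<open>Simplicial commutative rings\<close>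

text \<open>
  A simplicial ring is given by its levels, faces and degeneracies. With \<open>A\<^sub>n = level A n\<close>,
  \<open>face A n i\<close> is the \<open>i\<close>-th face map \<open>A\<^bsub>n+1\<^esub> \<rightarrow> A\<^sub>n\<close> (for \<open>i \<le> n + 1\<close>) and \<open>degen A n i\<close> is the
  \<open>i\<close>-th degeneracy \<open>A\<^sub>n \<rightarrow> A\<^bsub>n+1\<^esub>\<close> (for \<open>i \<le> n\<close>): the index is the lower of the two levels.
\<close>

record 'a simplicial =
  level :: "nat \<Rightarrow> 'a ring"
  face :: "nat \<Rightarrow> nat \<Rightarrow> 'a \<Rightarrow> 'a"
  degen :: "nat \<Rightarrow> nat \<Rightarrow> 'a \<Rightarrow> 'a"

locale simplicial_cring =
  fixes A :: "'a simplicial"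
  assumes cring_level: "cring (level A n)"
    and face_hom: "i \<le> Suc n \<Longrightarrow> face A n i \<in> ring_hom (level A (Suc n)) (level A n)"
    and degen_hom: "i \<le> n \<Longrightarrow> degen A n i \<in> ring_hom (level A n) (level A (Suc n))"
    and face_face:
      "\<lbrakk>x \<in> carrier (level A (Suc (Suc n))); i < j; j \<le> Suc (Suc n)\<rbrakk> \<Longrightarrow>
        face A n i (face A (Suc n) j x) = face A n (j - 1) (face A (Suc n) i x)"
    and degen_degen:
      "\<lbrakk>x \<in> carrier (level A n); i \<le> j; j \<le> n\<rbrakk> \<Longrightarrow>
        degen A (Suc n) i (degen A n j x) = degen A (Suc n) (Suc j) (degen A n i x)"
    and face_degen_less:
      "\<lbrakk>x \<in> carrier (level A (Suc n)); i < j; j \<le> Suc n\<rbrakk> \<Longrightarrow>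
        face A (Suc n) i (degen A (Suc n) j x) = degen A n (j - 1) (face A n i x)"
    and face_degen_same:
      "\<lbrakk>x \<in> carrier (level A n); j \<le> n; i = j \<or> i = Suc j\<rbrakk> \<Longrightarrow>
        face A n i (degen A n j x) = x"
    and face_degen_greater:
      "\<lbrakk>x \<in> carrier (level A (Suc n)); Suc j < i; i \<le> Suc (Suc n)\<rbrakk> \<Longrightarrow>
        face A (Suc n) i (degen A (Suc n) j x) = degen A n j (face A n (i - 1) x)"

definition simplicial_hom ::
  "'a simplicial \<Rightarrow> 'b simplicial \<Rightarrow> (nat \<Rightarrow> 'a \<Rightarrow> 'b) set"
  where "simplicial_hom A B =
    {f. (\<forall>n. f n \<in> ring_hom (level A n) (level B n)) \<and>
        (\<forall>n. \<forall>i\<le>Suc n. \<forall>x\<in>carrier (level A (Suc n)).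
           f n (face A n i x) = face B n i (f (Suc n) x)) \<and>
        (\<forall>n. \<forall>i\<le>n. \<forall>x\<in>carrier (level A n).
           f (Suc n) (degen A n i x) = degen B n i (f n x))}"

section \<open>Homotopy groups\<close>

text \<open>
  \<open>\<pi>\<^sub>n(A)\<close> is the homology of the normalised (Moore) complex \<open>N\<^sub>n = \<Inter>\<^bsub>0<i\<le>n\<^esub> ker d\<^sub>i\<close>, whose
  differential is \<open>d\<^sub>0\<close>.
\<close>

fun moore :: "'a simplicial \<Rightarrow> nat \<Rightarrow> 'a set"
  where
    "moore A 0 = carrier (level A 0)"
  | "moore A (Suc n) =
      {x \<in> carrier (level A (Suc n)). \<forall>i\<in>{1..Suc n}. face A n i x = \<zero>\<^bsub>level A n\<^esub>}"

fun moore_cycles :: "'a simplicial \<Rightarrow> nat \<Rightarrow> 'a set"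
  where
    "moore_cycles A 0 = moore A 0"
  | "moore_cycles A (Suc n) = {x \<in> moore A (Suc n). face A n 0 x = \<zero>\<^bsub>level A n\<^esub>}"

definition moore_boundaries :: "'a simplicial \<Rightarrow> nat \<Rightarrow> 'a set"
  where "moore_boundaries A n = face A n 0 ` moore A (Suc n)"

definition homotopy_group :: "'a simplicial \<Rightarrow> nat \<Rightarrow> 'a set monoid"
  where "homotopy_group A n =
    (add_monoid (level A n))\<lparr>carrier := moore_cycles A n\<rparr> Mod moore_boundaries A n"

text \<open>The map \<open>\<pi>\<^sub>n(A) \<rightarrow> \<pi>\<^sub>n(B)\<close> induced by \<open>f\<close>, sending the class of \<open>x\<close> to the class of \<open>f\<^sub>n(x)\<close>.\<close>

definition homotopy_map ::
  "'a simplicial \<Rightarrow> 'b simplicial \<Rightarrow> (nat \<Rightarrow> 'a \<Rightarrow> 'b) \<Rightarrow> nat \<Rightarrow> 'a set \<Rightarrow> 'b set"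
  where "homotopy_map A B f n C = moore_boundaries B n <+>\<^bsub>level B n\<^esub> (f n ` C)"

text \<open>
  Cosimplicial affine schemes are treated through the opposite category: a morphism
  \<open>Spec B \<rightarrow> Spec A\<close> is a morphism \<open>f : A \<rightarrow> B\<close> of simplicial commutative rings.
\<close>

definition weak_equivalence ::
  "'a simplicial \<Rightarrow> 'b simplicial \<Rightarrow> (nat \<Rightarrow> 'a \<Rightarrow> 'b) \<Rightarrow> bool"
  where "weak_equivalence A B f \<longleftrightarrow>
    simplicial_cring A \<and> simplicial_cring B \<and> f \<in> simplicial_hom A B \<and>
    (\<forall>n. homotopy_map A B f n \<in> iso (homotopy_group A n) (homotopy_group B n))"

section \<open>Completion along the augmentation to the zeroth homotopy ring\<close>

definition pi0_ring :: "'a simplicial \<Rightarrow> 'a set ring"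
  where "pi0_ring A = level A 0 Quot moore_boundaries A 0"

text \<open>
  The canonical map \<open>A\<^sub>n \<rightarrow> \<pi>\<^sub>0(A)\<close> factors through any vertex map \<open>A\<^sub>n \<rightarrow> A\<^sub>0\<close>; all vertex maps agree
  after passing to \<open>\<pi>\<^sub>0(A)\<close>. The one used here is \<open>d\<^sub>1 d\<^sub>2 \<dots> d\<^sub>n\<close>.
\<close>

fun vertex :: "'a simplicial \<Rightarrow> nat \<Rightarrow> 'a \<Rightarrow> 'a"
  where
    "vertex A 0 x = x"
  | "vertex A (Suc n) x = vertex A n (face A n (Suc n) x)"

definition augmentation :: "'a simplicial \<Rightarrow> nat \<Rightarrow> 'a \<Rightarrow> 'a set"
  where "augmentation A n x = moore_boundaries A 0 +>\<^bsub>level A 0\<^esub> vertex A n x"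

definition aug_ideal :: "'a simplicial \<Rightarrow> nat \<Rightarrow> 'a set"
  where "aug_ideal A n = a_kernel (level A n) (pi0_ring A) (augmentation A n)"

definition ideal_power :: "('a, 'b) ring_scheme \<Rightarrow> 'a set \<Rightarrow> nat \<Rightarrow> 'a set"
  where "ideal_power R I m = I [^]\<^bsub>ideals_set R\<^esub> m"

text \<open>
  Elements of \<open>lim\<^sub>m R/I\<^sup>m\<close> are compatible sequences of cosets. The transition map
  \<open>R/I\<^bsup>m+1\<^esup> \<rightarrow> R/I\<^sup>m\<close> sends a coset \<open>C\<close> to \<open>I\<^sup>m + C\<close>.
\<close>

definition adic_completion :: "('a, 'b) ring_scheme \<Rightarrow> 'a set \<Rightarrow> (nat \<Rightarrow> 'a set) ring"
  where "adic_completion R I =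
    \<lparr>carrier = {s. \<forall>m. s m \<in> carrier (R Quot ideal_power R I m) \<and>
                       ideal_power R I m <+>\<^bsub>R\<^esub> s (Suc m) = s m},
     monoid.mult = (\<lambda>s t m. s m \<otimes>\<^bsub>R Quot ideal_power R I m\<^esub> t m),
     monoid.one = (\<lambda>m. \<one>\<^bsub>R Quot ideal_power R I m\<^esub>),
     ring.zero = (\<lambda>m. \<zero>\<^bsub>R Quot ideal_power R I m\<^esub>),
     ring.add = (\<lambda>s t m. s m \<oplus>\<^bsub>R Quot ideal_power R I m\<^esub> t m)\<rparr>"

definition completion_unit :: "('a, 'b) ring_scheme \<Rightarrow> 'a set \<Rightarrow> 'a \<Rightarrow> nat \<Rightarrow> 'a set"
  where "completion_unit R I x = (\<lambda>m. ideal_power R I m +>\<^bsub>R\<^esub> x)"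

text \<open>
  For a ring homomorphism \<open>h : R \<rightarrow> S\<close> with \<open>h(I) \<subseteq> J\<close>, the following is the induced map from the
  \<open>I\<close>-adic completion of \<open>R\<close> to the \<open>J\<close>-adic completion of \<open>S\<close>; it depends on \<open>R\<close> and \<open>I\<close> only
  through its argument.
\<close>

definition completion_map ::
  "('b, 'c) ring_scheme \<Rightarrow> 'b set \<Rightarrow> ('a \<Rightarrow> 'b) \<Rightarrow> (nat \<Rightarrow> 'a set) \<Rightarrow> nat \<Rightarrow> 'b set"
  where "completion_map S J h s = (\<lambda>m. ideal_power S J m <+>\<^bsub>S\<^esub> (h ` s m))"

definition simplicial_completion :: "'a simplicial \<Rightarrow> (nat \<Rightarrow> 'a set) simplicial"
  where "simplicial_completion A =
    \<lparr>level = (\<lambda>n. adic_completion (level A n) (aug_ideal A n)),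
     face = (\<lambda>n i. completion_map (level A n) (aug_ideal A n) (face A n i)),
     degen = (\<lambda>n i. completion_map (level A (Suc n)) (aug_ideal A (Suc n)) (degen A n i))\<rparr>"

definition canonical_map :: "'a simplicial \<Rightarrow> nat \<Rightarrow> 'a \<Rightarrow> nat \<Rightarrow> 'a set"
  where "canonical_map A n = completion_unit (level A n) (aug_ideal A n)"

end

theory Submission
  imports Defs
begin

text \<open>
  Let \<open>I\<close> be the augmentation ideal. The key point is that the inverse system \<open>\<pi>\<^sub>n(I\<^sup>m)\<close> is
  pro-zero. More generally, for simplicial ideals \<open>I\<close>, \<open>N\<close> with \<open>\<pi>\<^sub>0(I) = 0\<close> the system
  \<open>\<pi>\<^sub>n(I\<^sup>m N)\<close> is pro-zero, by induction on \<open>n\<close> over all levelwise Noetherian simplicial rings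
  at once. Let \<open>D\<close> be the decalage of \<open>A\<close>, \<open>D\<^sub>n = A\<^bsub>n+1\<^esub>\<close>, with the surjection
  \<open>d\<^sub>0 : D \<rightarrow> A\<close>, and let \<open>K \<subseteq> D\<close> consist of the elements of \<open>I\<close> with initial vertex \<open>0\<close>. Then
  \<open>K\<close> maps onto \<open>I\<close>, so a cycle of \<open>I\<^sup>m N\<close> lifts to \<open>K\<^sup>m N\<close> in \<open>D\<close>. The boundary of the lift lies in
  \<open>K\<^sup>m N \<inter> ker d\<^sub>0\<close>, which by Artin--Rees is contained in \<open>K\<^sup>s T\<close> for \<open>T = N \<inter> ker d\<^sub>0\<close> and \<open>m\<close> large;
  the induction hypothesis for \<open>(D, K, T)\<close> corrects the lift to a cycle of \<open>D\<close>, and a cycle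
  of \<open>D\<close> is, viewed in \<open>A\<close> one degree higher, a bounding chain. Pro-vanishing gives the theorem
  as in the Milnor sequence: bounding chains of successive approximations are summed in the completion.
\<close>

section \<open>Cosets and quotient maps\<close>

text \<open>As \<open>h\<close> maps \<open>B\<close> into \<open>C\<close>, multiplying by
  \<open>C\<close> absorbs the image of all of \<open>B\<close>. Hence the set-level formulas in
  \<open>homotopy_map\<close> and \<open>completion_map\<close> are the usual maps induced on
  quotients.\<close>

lemma r_coset_image:
  assumes "group G" "group H" "subgroup B G" "subgroup C H" "h \<in> hom G H" "h ` B \<subseteq> C" "x \<in> carrier G"
  shows "C <#>\<^bsub>H\<^esub> (h ` (B #>\<^bsub>G\<^esub> x)) = C #>\<^bsub>H\<^esub> h x"
proof -
  interpret G: group G by fact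
  interpret H: group H by fact
  interpret B: subgroup B G by fact
  interpret C: subgroup C H by fact
  note h = hom_in_carrier[OF assms(5)] hom_mult[OF assms(5)]
  show ?thesis unfolding set_mult_def r_coset_def
  proof safe
    fix c b assume cb: "c \<in> C" "b \<in> B"
    then have "h b \<in> C" using assms(6) by blast
    then have "c \<otimes>\<^bsub>H\<^esub> h (b \<otimes>\<^bsub>G\<^esub> x) = (c \<otimes>\<^bsub>H\<^esub> h b) \<otimes>\<^bsub>H\<^esub> h x"
      using cb h assms(7) by (simp add: H.m_assoc)
    then show "c \<otimes>\<^bsub>H\<^esub> h (b \<otimes>\<^bsub>G\<^esub> x) \<in> (\<Union>k\<in>C. {k \<otimes>\<^bsub>H\<^esub> h x})"
      using \<open>h b \<in> C\<close> cb(1) by auto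
  next
    fix c assume "c \<in> C"
    then show "c \<otimes>\<^bsub>H\<^esub> h x \<in> (\<Union>k\<in>C. \<Union>y\<in>h ` (\<Union>k\<in>B. {k \<otimes>\<^bsub>G\<^esub> x}). {k \<otimes>\<^bsub>H\<^esub> y})"
      using B.one_closed G.l_one[OF assms(7)] by (auto intro!: bexI[of _ c] bexI[of _ "\<one>\<^bsub>G\<^esub>"])
  qed
qed

text \<open>A criterion on representatives: injectivity and surjectivity modulo the subgroups are
  conditions on elements of \<open>G\<close> and \<open>H\<close>, so homotopy groups can be
  compared by working with cycles and boundaries alone.\<close>

lemma FactGroup_map_iso:
  assumes G: "comm_group G" and H: "comm_group H" and B: "subgroup B G" and C: "subgroup C H"
    and h: "h \<in> hom G H" "h ` B \<subseteq> C"
    and inj: "\<And>x. x \<in> carrier G \<Longrightarrow> h x \<in> C \<Longrightarrow> x \<in> B"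
    and surj: "\<And>y. y \<in> carrier H \<Longrightarrow> \<exists>x\<in>carrier G. \<exists>c\<in>C. y = c \<otimes>\<^bsub>H\<^esub> h x"
  shows "(\<lambda>U. C <#>\<^bsub>H\<^esub> (h ` U)) \<in> iso (G Mod B) (H Mod C)"
proof -
  interpret G: comm_group G by fact
  interpret H: comm_group H by fact
  interpret B: normal B G by (rule G.subgroup_imp_normal[OF B])
  interpret C: normal C H by (rule H.subgroup_imp_normal[OF C])
  interpret h: group_hom G H h
    by (intro group_hom.intro G.group_axioms H.group_axioms group_hom_axioms.intro h)
  let ?f = "\<lambda>U. C <#>\<^bsub>H\<^esub> (h ` U)"
  have f: "?f (B #>\<^bsub>G\<^esub> x) = C #>\<^bsub>H\<^esub> h x" if "x \<in> carrier G" for x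
    by (rule r_coset_image[OF G.group_axioms H.group_axioms B C h that])
  have carG: "carrier (G Mod B) = (\<lambda>x. B #>\<^bsub>G\<^esub> x) ` carrier G"
    and carH: "carrier (H Mod C) = (\<lambda>x. C #>\<^bsub>H\<^esub> x) ` carrier H"
    by (auto simp: FactGroup_def RCOSETS_def)
  have mG: "U \<otimes>\<^bsub>G Mod B\<^esub> V = U <#>\<^bsub>G\<^esub> V" and mH: "U' \<otimes>\<^bsub>H Mod C\<^esub> V' = U' <#>\<^bsub>H\<^esub> V'"
    for U V U' V' by (simp_all add: FactGroup_def)
  show ?thesis
  proof (rule isoI)
    show "?f \<in> hom (G Mod B) (H Mod C)"
    proof (rule homI)
      fix U assume "U \<in> carrier (G Mod B)"
      then obtain x where x: "x \<in> carrier G" "U = B #>\<^bsub>G\<^esub> x" using carG by blast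
      show "?f U \<in> carrier (H Mod C)" using x carH f by auto
      fix V assume "V \<in> carrier (G Mod B)"
      then obtain y where y: "y \<in> carrier G" "V = B #>\<^bsub>G\<^esub> y" using carG by blast
      show "?f (U \<otimes>\<^bsub>G Mod B\<^esub> V) = ?f U \<otimes>\<^bsub>H Mod C\<^esub> ?f V"
        using x y by (simp add: mG mH f B.rcos_sum C.rcos_sum)
    qed
    show "bij_betw ?f (carrier (G Mod B)) (carrier (H Mod C))"
    proof (rule bij_betwI')
      fix U V assume UV: "U \<in> carrier (G Mod B)" "V \<in> carrier (G Mod B)"
      obtain x where x: "x \<in> carrier G" "U = B #>\<^bsub>G\<^esub> x" using UV(1) carG by blast
      obtain y where y: "y \<in> carrier G" "V = B #>\<^bsub>G\<^esub> y" using UV(2) carG by blast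
      show "?f U = ?f V \<longleftrightarrow> U = V"
      proof
        assume "?f U = ?f V"
        then have "C #>\<^bsub>H\<^esub> h x = C #>\<^bsub>H\<^esub> h y" using x y f by simp
        then have "h x \<in> C #>\<^bsub>H\<^esub> h y" using H.rcos_self[OF _ C, of "h x"] x(1) by simp
        then have "h x \<otimes>\<^bsub>H\<^esub> inv\<^bsub>H\<^esub> h y \<in> C"
          using C.rcos_module[OF H.group_axioms] x(1) y(1) by simp
        then have "h (x \<otimes>\<^bsub>G\<^esub> inv\<^bsub>G\<^esub> y) \<in> C" using x(1) y(1) by simp
        then have "x \<otimes>\<^bsub>G\<^esub> inv\<^bsub>G\<^esub> y \<in> B" using x(1) y(1) by (intro inj) simp_all
        then have "x \<in> B #>\<^bsub>G\<^esub> y" using B.rcos_module[OF G.group_axioms] x(1) y(1) by simp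
        then show "U = V" using G.repr_independence[OF _ y(1) B] x(2) y(2) by simp
      qed simp
    next
      fix U assume "U \<in> carrier (G Mod B)"
      then show "?f U \<in> carrier (H Mod C)" using carG carH f by auto
    next
      fix V assume "V \<in> carrier (H Mod C)"
      then obtain y where y: "y \<in> carrier H" "V = C #>\<^bsub>H\<^esub> y" using carH by blast
      then obtain x c where x: "x \<in> carrier G" "c \<in> C" "y = c \<otimes>\<^bsub>H\<^esub> h x" using surj by blast
      have "y \<in> C #>\<^bsub>H\<^esub> h x" using x by (auto simp: r_coset_def)
      then have "C #>\<^bsub>H\<^esub> h x = V" using H.repr_independence[OF _ _ C, of y "h x"] x y(2) by simp
      then show "\<exists>U\<in>carrier (G Mod B). V = ?f U" using f[OF x(1)] x(1) carG by blast
    qed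
  qed
qed

lemma (in abelian_group) additive_subgroup_byI:
  assumes "H \<subseteq> carrier G" "\<zero> \<in> H" "\<And>a. a \<in> H \<Longrightarrow> \<ominus> a \<in> H"
    "\<And>a b. a \<in> H \<Longrightarrow> b \<in> H \<Longrightarrow> a \<oplus> b \<in> H"
  shows "additive_subgroup H G"
  using assms by (intro additive_subgroupI add.subgroupI) auto

lemma (in abelian_group) add_minus_cancel_left:
  "a \<in> carrier G \<Longrightarrow> b \<in> carrier G \<Longrightarrow> (a \<oplus> b) \<ominus> a = b"
  by (simp add: minus_eq a_comm[of a b] a_assoc r_neg)

lemma (in abelian_group) minus_telescope:
  assumes "a \<in> carrier G" "b \<in> carrier G" "c \<in> carrier G"
  shows "(a \<ominus> c) \<oplus> (b \<ominus> a) = b \<ominus> c"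
proof -
  have "(a \<ominus> c) \<oplus> (b \<ominus> a) = (b \<ominus> a) \<oplus> (a \<ominus> c)" using assms by (intro a_comm) simp_all
  also have "\<dots> = b \<oplus> ((\<ominus> a \<oplus> a) \<ominus> c)" using assms by (simp add: minus_eq a_assoc)
  finally show ?thesis using assms by (simp add: l_neg minus_eq)
qed

text \<open>\<open>h\<close> is only required to be additive on the carrier; the uses are the
  identity, for the transition maps of the completion, and ring homomorphisms, for
  \<open>completion_map\<close>.\<close>

lemma add_coset_image:
  assumes "abelian_group R" "abelian_group S" "additive_subgroup K R" "additive_subgroup J S"
    and h: "\<And>x. x \<in> carrier R \<Longrightarrow> h x \<in> carrier S"
      "\<And>x y. x \<in> carrier R \<Longrightarrow> y \<in> carrier R \<Longrightarrow> h (x \<oplus>\<^bsub>R\<^esub> y) = h x \<oplus>\<^bsub>S\<^esub> h y"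
    and "h ` K \<subseteq> J" "x \<in> carrier R"
  shows "J <+>\<^bsub>S\<^esub> (h ` (K +>\<^bsub>R\<^esub> x)) = J +>\<^bsub>S\<^esub> h x"
proof -
  have "h \<in> hom (add_monoid R) (add_monoid S)" using h by (intro homI) simp_all
  from r_coset_image[OF abelian_group.a_group abelian_group.a_group
      additive_subgroup.a_subgroup additive_subgroup.a_subgroup this, OF assms(1-4,7)]
  show ?thesis using assms(8) by (simp add: set_add_def a_r_coset_def)
qed

section \<open>Powers of ideals and the Artin--Rees property\<close>

lemma ideal_power_0: "ideal_power R I 0 = carrier R"
  by (simp add: ideal_power_def ideals_set_def)

lemma ideal_power_Suc: "ideal_power R I (Suc m) = ideal_power R I m \<cdot>\<^bsub>R\<^esub> I"
  by (simp add: ideal_power_def ideals_set_def)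

lemma ideal_prod_mono:
  assumes "I \<subseteq> I'" "J \<subseteq> J'"
  shows "I \<cdot>\<^bsub>R\<^esub> J \<subseteq> I' \<cdot>\<^bsub>R\<^esub> J'"
proof
  fix x assume "x \<in> I \<cdot>\<^bsub>R\<^esub> J"
  then show "x \<in> I' \<cdot>\<^bsub>R\<^esub> J'"
    using assms by (induction rule: ideal_prod.induct) (auto intro: ideal_prod.intros)
qed

lemma ideal_power_mono: "I \<subseteq> J \<Longrightarrow> ideal_power R I m \<subseteq> ideal_power R J m"
  by (induction m) (simp_all add: ideal_power_0 ideal_power_Suc ideal_prod_mono)

section \<open>Inclusions between products and powers of ideals\<close>

context ring
begin

lemma ideal_prod_leI:
  assumes "ideal K R" "\<And>i j. i \<in> I \<Longrightarrow> j \<in> J \<Longrightarrow> i \<otimes> j \<in> K"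
  shows "I \<cdot> J \<subseteq> K"
proof
  fix x assume "x \<in> I \<cdot> J"
  then show "x \<in> K"
    by (induction rule: ideal_prod.induct)
      (use assms in \<open>auto simp: additive_subgroup.a_closed ideal.axioms(1)\<close>)
qed

lemma ideal_power_ideal: "ideal I R \<Longrightarrow> ideal (ideal_power R I m) R"
  by (induction m) (simp_all add: ideal_power_0 ideal_power_Suc oneideal ideal_prod_is_ideal)

lemma ideal_power_Suc_subset: "ideal I R \<Longrightarrow> ideal_power R I (Suc m) \<subseteq> ideal_power R I m"
  using ideal_prod_inter[OF ideal_power_ideal] by (auto simp: ideal_power_Suc)

lemma ideal_power_antimono:
  assumes "ideal I R" "k \<le> m"
  shows "ideal_power R I m \<subseteq> ideal_power R I k"
  using assms(2) by (induction rule: dec_induct) (use ideal_power_Suc_subset[OF assms(1)] in auto)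

lemma ideal_minus_closed: "ideal I R \<Longrightarrow> a \<in> I \<Longrightarrow> b \<in> I \<Longrightarrow> a \<ominus> b \<in> I"
  by (simp add: a_minus_def additive_subgroup.a_closed additive_subgroup.a_inv_closed
      ideal.axioms(1) abelian_group_axioms)

end

lemma (in cring) ideal_power_1: "ideal I R \<Longrightarrow> ideal_power R I 1 = I"
  by (simp add: ideal_power_0 ideal_power_Suc ideal_prod_commute[OF oneideal] ideal_prod_one)

lemma (in cring) ideal_power_mult:
  assumes "ideal I R"
  shows "ideal_power R (ideal_power R I k) m = ideal_power R I (k * m)"
proof -
  interpret M: comm_monoid "ideals_set R" by (rule ideals_set_is_comm_monoid)
  have "I \<in> carrier (ideals_set R)" using assms by (simp add: ideals_set_def)
  then show ?thesis unfolding ideal_power_def by (rule M.nat_pow_pow)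
qed

text \<open>This is the colon ideal \<open>(N : x)\<close>. Taken for the powers of one element,
  such ideals form the ascending chain behind the Artin--Rees argument.\<close>

lemma (in cring) colon_ideal:
  assumes "ideal N R" "x \<in> carrier R"
  shows "ideal {a \<in> carrier R. a \<otimes> x \<in> N} R"
proof -
  interpret ideal N R by fact
  show ?thesis
  proof (rule idealI)
    show "subgroup {a \<in> carrier R. a \<otimes> x \<in> N} (add_monoid R)"
      by (rule add.subgroupI)
        (use assms(2) in \<open>auto simp: l_distr l_minus a_inv_def[symmetric]\<close>)
  next
    fix a y assume "a \<in> {a \<in> carrier R. a \<otimes> x \<in> N}" "y \<in> carrier R"
    then have "y \<in> carrier R" "a \<in> carrier R" "y \<otimes> (a \<otimes> x) \<in> N" by (auto intro: I_l_closed)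
    then show "y \<otimes> a \<in> {a \<in> carrier R. a \<otimes> x \<in> N}" "a \<otimes> y \<in> {a \<in> carrier R. a \<otimes> x \<in> N}"
      using assms(2) by (auto simp: m_assoc m_lcomm)
  qed (rule ring_axioms)
qed

section \<open>Ideals enlarged by a principal ideal, and generators that are nilpotent modulo an
  ideal\<close>

lemma (in ring) add_principal_iff:
  "y \<in> N <+>\<^bsub>R\<^esub> PIdl x \<longleftrightarrow> (\<exists>n\<in>N. \<exists>r\<in>carrier R. y = n \<oplus> r \<otimes> x)"
  by (auto simp: set_add_def' cgenideal_def)

lemma (in ring) add_principal_contains:
  assumes "ideal N R" "x \<in> carrier R"
  shows "N \<subseteq> N <+>\<^bsub>R\<^esub> PIdl x" "x \<in> N <+>\<^bsub>R\<^esub> PIdl x"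
proof -
  interpret ideal N R by fact
  show "N \<subseteq> N <+>\<^bsub>R\<^esub> PIdl x"
  proof
    fix n assume "n \<in> N"
    moreover from this have "n = n \<oplus> \<zero> \<otimes> x" using assms(2) by simp
    ultimately show "n \<in> N <+>\<^bsub>R\<^esub> PIdl x" unfolding add_principal_iff by blast
  qed
  show "x \<in> N <+>\<^bsub>R\<^esub> PIdl x"
    unfolding add_principal_iff using assms(2) by (intro bexI[of _ \<zero>] bexI[of _ \<one>]) auto
qed

text \<open>When a product of \<open>k\<close> sums is expanded, every term other than the pure
  multiple of \<open>x^k\<close> has a factor in \<open>N\<close>.\<close>

lemma (in cring) ideal_power_add_principal:
  assumes N: "ideal N R" and x: "x \<in> carrier R"
  shows "ideal_power R (N <+>\<^bsub>R\<^esub> PIdl x) k \<subseteq> N <+>\<^bsub>R\<^esub> PIdl (x [^] k)"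
proof (induction k)
  case 0
  have "PIdl \<one> = carrier R"
    by (force simp: cgenideal_def)
  then show ?case
    using ideal_power_ideal[OF add_ideals[OF N cgenideal_ideal[OF x]]]
      additive_subgroup.zero_closed[OF ideal.axioms(1)[OF N]]
    by (force simp: ideal_power_0 set_add_def')
next
  case (Suc k)
  interpret N: ideal N R by fact
  show ?case unfolding ideal_power_Suc
  proof (rule ideal_prod_leI)
    show "ideal (N <+>\<^bsub>R\<^esub> PIdl (x [^] Suc k)) R"
      by (intro add_ideals N cgenideal_ideal nat_pow_closed x)
  next
    fix i j assume "i \<in> ideal_power R (N <+>\<^bsub>R\<^esub> PIdl x) k" "j \<in> N <+>\<^bsub>R\<^esub> PIdl x"
    then obtain a r b s where i: "i = a \<oplus> r \<otimes> x [^] k" and j: "j = b \<oplus> s \<otimes> x"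
      and mem: "a \<in> N" "b \<in> N" "r \<in> carrier R" "s \<in> carrier R"
      using Suc by (auto simp: subset_iff add_principal_iff)
    have "i \<otimes> j = (a \<otimes> j \<oplus> (r \<otimes> x [^] k) \<otimes> b) \<oplus> (r \<otimes> s) \<otimes> x [^] Suc k"
      using i j mem x N.Icarr[of a] N.Icarr[of b]
      by (simp add: l_distr r_distr a_assoc m_ac a_ac)
    moreover have "j \<in> carrier R" using j mem x by simp
    then have "a \<otimes> j \<oplus> (r \<otimes> x [^] k) \<otimes> b \<in> N"
      using mem x by (simp add: N.I_l_closed N.I_r_closed)
    ultimately show "i \<otimes> j \<in> N <+>\<^bsub>R\<^esub> PIdl (x [^] Suc k)"
      using mem unfolding add_principal_iff by (meson m_closed)
  qed
qed

text \<open>Generators are absorbed one at a time. Adjoining \<open>a\<close> to \<open>N\<close>,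
  the induction hypothesis puts \<open>J^M\<close> into \<open>N + (a)\<close>; if
  \<open>a^k\<close> lies in \<open>N\<close>, then the \<open>k\<close>-th power of
  \<open>N + (a)\<close> lies in \<open>N\<close>, so the exponent \<open>M * k\<close>
  suffices.\<close>

lemma (in cring) ideal_power_subset_of_nilpotent_gens:
  assumes "finite S" "S \<subseteq> carrier R" "ideal J R" "ideal N R" "J \<subseteq> Idl (N \<union> S)"
    and "\<And>a. a \<in> S \<Longrightarrow> \<exists>k::nat. a [^] k \<in> N"
  shows "\<exists>M. ideal_power R J M \<subseteq> N"
  using assms
proof (induction S arbitrary: N)
  case empty
  have "ideal_power R J 1 \<subseteq> N"
    using empty.prems(4) genideal_minimal[OF empty.prems(3) order_refl]
    unfolding ideal_power_1[OF empty.prems(2)] by simp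
  then show ?case ..
next
  case (insert a S)
  let ?N1 = "N <+>\<^bsub>R\<^esub> PIdl a"
  have a: "a \<in> carrier R" using insert by simp
  have N1: "ideal ?N1 R" by (intro add_ideals insert cgenideal_ideal a)
  have sub: "N \<subseteq> ?N1" "a \<in> ?N1"
    using add_principal_contains[OF insert.prems(3) a] by blast+
  have "Idl (N \<union> insert a S) \<subseteq> Idl (?N1 \<union> S)"
    using genideal_ideal[of "?N1 \<union> S"] genideal_self[of "?N1 \<union> S"] insert.prems(1) sub
      additive_subgroup.a_subset[OF ideal.axioms(1)[OF N1]] by (intro genideal_minimal) auto
  then have "J \<subseteq> Idl (?N1 \<union> S)" using insert.prems by blast
  moreover have "\<And>b. b \<in> S \<Longrightarrow> \<exists>k::nat. b [^] k \<in> ?N1" using insert.prems sub by blast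
  ultimately obtain M where M: "ideal_power R J M \<subseteq> ?N1"
    using insert.IH[of ?N1] insert.prems N1 by blast
  obtain k :: nat where k: "a [^] k \<in> N" using insert.prems by blast
  have "ideal_power R J (M * k) \<subseteq> ideal_power R ?N1 k"
    using ideal_power_mono[OF M] ideal_power_mult[OF insert.prems(2)] by metis
  also have "\<dots> \<subseteq> N <+>\<^bsub>R\<^esub> PIdl (a [^] k)"
    by (rule ideal_power_add_principal[OF insert.prems(3) a])
  also have "\<dots> \<subseteq> N"
    using k insert.prems(3) by (auto simp: add_principal_iff
        intro!: additive_subgroup.a_closed[OF ideal.axioms(1)] ideal.I_l_closed)
  finally show ?case by blast
qed

text \<open>In a Noetherian ring the union of a nonempty chain of ideals is a member of the chain,
  so Zorn's lemma applies to every nonempty family.\<close>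

lemma (in noetherian_ring) maximal_ideal_in_family:
  assumes "F \<noteq> {}" "\<And>I. I \<in> F \<Longrightarrow> ideal I R"
  shows "\<exists>M\<in>F. \<forall>L\<in>F. M \<subseteq> L \<longrightarrow> L = M"
proof (rule subset_Zorn_nonempty[OF assms(1)])
  fix C assume "C \<noteq> {}" "subset.chain F C"
  moreover from this have "subset.chain {I. ideal I R} C"
    using assms(2) by (auto simp: pred_on.chain_def)
  ultimately show "\<Union>C \<in> F" using ideal_chain_is_trivial[of C] by (auto simp: pred_on.chain_def)
qed

text \<open>A weak form of the Artin--Rees lemma, after Krull: an ideal \<open>N \<supseteq> K\<^sup>s T\<close> maximal among those
  meeting \<open>T\<close> in \<open>K\<^sup>s T\<close> contains a power of \<open>K\<close>.\<close>

lemma artin_rees_weak: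
  fixes R (structure)
  assumes "cring R" "noetherian_ring R" and K: "ideal K R" and T: "ideal T R"
  shows "\<exists>m. ideal_power R K m \<inter> T \<subseteq> ideal_power R K s \<cdot> T"
proof -
  interpret cring R by fact
  interpret noetherian_ring R by fact
  define J where "J = ideal_power R K s"
  have J: "ideal J R" unfolding J_def by (rule ideal_power_ideal[OF K])
  have JT: "ideal (J \<cdot> T) R" by (rule ideal_prod_is_ideal[OF J T])
  define F where "F = {N. ideal N R \<and> J \<cdot> T \<subseteq> N \<and> N \<inter> T = J \<cdot> T}"
  have "J \<cdot> T \<in> F" using JT ideal_prod_inter[OF J T] by (auto simp: F_def)
  then have "\<exists>M\<in>F. \<forall>L\<in>F. M \<subseteq> L \<longrightarrow> L = M"
    by (intro maximal_ideal_in_family) (unfold F_def, blast+)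
  then obtain N where NF: "N \<in> F" and max: "\<And>L. L \<in> F \<Longrightarrow> N \<subseteq> L \<Longrightarrow> L = N"
    by blast
  have N: "ideal N R" "J \<cdot> T \<subseteq> N" "N \<inter> T = J \<cdot> T" using NF unfolding F_def by blast+
  interpret N: ideal N R by fact
  have nil: "\<exists>k::nat. x [^] k \<in> N" if xJ: "x \<in> J" for x
  proof -
    have x: "x \<in> carrier R" using ideal.Icarr[OF J xJ] .
    \<comment> \<open>The ideals \<open>(N : x^k)\<close> ascend with \<open>k\<close>. A maximal
      member of the family marks an index from which the chain does not grow.\<close>
    define C where "C k = {a \<in> carrier R. a \<otimes> x [^] k \<in> N}" for k :: nat
    have "ideal (C k) R" for k unfolding C_def by (rule colon_ideal[OF N(1) nat_pow_closed[OF x]])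
    then have "\<exists>M\<in>range C. \<forall>L\<in>range C. M \<subseteq> L \<longrightarrow> L = M"
      by (intro maximal_ideal_in_family) blast+
    then obtain k where k: "\<forall>j. C k \<subseteq> C j \<longrightarrow> C j = C k" unfolding bex_simps ball_simps by (elim exE)
    have "C k \<subseteq> C (Suc k)"
    proof
      fix a assume a: "a \<in> C k"
      then have "a \<otimes> x [^] k \<otimes> x \<in> N"
        by (intro N.I_r_closed[OF _ x]) (simp add: C_def)
      moreover have "a \<in> carrier R" using a by (simp add: C_def)
      ultimately show "a \<in> C (Suc k)" by (simp add: C_def m_assoc x)
    qed
    then have Ck: "C (Suc k) = C k" by (rule k[rule_format])
    let ?X = "N <+>\<^bsub>R\<^esub> PIdl (x [^] k)"
    have xk: "x [^] k \<in> carrier R" using x by simp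
    have X: "ideal ?X R" by (intro add_ideals N(1) cgenideal_ideal xk)
    have NX: "N \<subseteq> ?X" and xX: "x [^] k \<in> ?X"
      using add_principal_contains[OF N(1) xk] by blast+
    \<comment> \<open>This shows that \<open>N + (x^k)\<close> meets \<open>T\<close> only in
      \<open>J T\<close>. For \<open>y = n + r x^k\<close> in \<open>T\<close>, the product
      \<open>x y\<close> lies in \<open>J T\<close> and so in \<open>N\<close>; hence
      \<open>r x^(k+1)\<close> is in \<open>N\<close>, and by stationarity so is
      \<open>r x^k\<close>. Maximality of \<open>N\<close> then forces \<open>x^k\<close> into
      \<open>N\<close>.\<close>
    have "y \<in> N" if "y \<in> ?X" "y \<in> T" for y
    proof -
      obtain n r where y: "y = n \<oplus> r \<otimes> x [^] k" "n \<in> N" "r \<in> carrier R"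
        using \<open>y \<in> ?X\<close> by (auto simp: add_principal_iff)
      have n: "n \<in> carrier R" by (rule N.Icarr[OF y(2)])
      have "x \<otimes> y \<in> N" using ideal_prod.prod[OF xJ \<open>y \<in> T\<close>, of R] N(2) by blast
      then have "x \<otimes> y \<ominus> x \<otimes> n \<in> N"
        by (rule ideal_minus_closed[OF N(1) _ N.I_l_closed[OF y(2) x]])
      also have "x \<otimes> y \<ominus> x \<otimes> n = r \<otimes> x [^] Suc k"
        unfolding y(1) nat_pow_Suc using y(3) x n xk by algebra
      finally have "r \<in> C (Suc k)" using y by (simp add: C_def)
      then have "r \<otimes> x [^] k \<in> N" unfolding Ck by (simp add: C_def)
      then show "y \<in> N" unfolding y(1) by (rule N.a_closed[OF y(2)])
    qed
    then have "?X \<in> F" using X NX N by (auto simp: F_def)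
    then have "?X = N" using max NX by blast
    then show ?thesis using xX by blast
  qed
  obtain S where S: "S \<subseteq> carrier R" "finite S" "J = Idl S" using finetely_gen[OF J] by blast
  have NS: "N \<union> S \<subseteq> carrier R" using S N.a_subset by blast
  have "J \<subseteq> Idl (N \<union> S)" unfolding S(3)
    using genideal_minimal[OF genideal_ideal[OF NS]] genideal_self[OF NS] by blast
  moreover have "S \<subseteq> J" unfolding S(3) by (rule genideal_self[OF S(1)])
  ultimately obtain M where M: "ideal_power R J M \<subseteq> N"
    using ideal_power_subset_of_nilpotent_gens[OF S(2,1) J N(1)] nil by blast
  \<comment> \<open>The exponent is \<open>s * M\<close> because \<open>J\<close> is
    \<open>K^s\<close> and the \<open>M\<close>-th power of \<open>J\<close> lies in
    \<open>N\<close>.\<close>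
  have "ideal_power R K (s * M) \<inter> T \<subseteq> J \<cdot> T"
    using M N(3) ideal_power_mult[OF K] by (auto simp: J_def)
  then show ?thesis unfolding J_def by blast
qed

section \<open>Ideal products and powers under ring homomorphisms\<close>

lemma ideal_prod_image_subset:
  assumes "h \<in> ring_hom R S" "I \<subseteq> carrier R" "J \<subseteq> carrier R" "ring R"
    and "h ` I \<subseteq> I'" "h ` J \<subseteq> J'"
  shows "h ` (I \<cdot>\<^bsub>R\<^esub> J) \<subseteq> I' \<cdot>\<^bsub>S\<^esub> J'"
proof clarify
  interpret ring R by fact
  fix x assume "x \<in> I \<cdot>\<^bsub>R\<^esub> J"
  \<comment> \<open>Membership in the carrier is carried through the induction, since
    \<open>h\<close> is known to be additive and multiplicative only there.\<close>
  then have "x \<in> carrier R \<and> h x \<in> I' \<cdot>\<^bsub>S\<^esub> J'"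
  proof (induction rule: ideal_prod.induct)
    case (prod i j)
    then have "i \<in> carrier R" "j \<in> carrier R" "h i \<in> I'" "h j \<in> J'" using assms by blast+
    then show ?case
      using ring_hom_mult[OF assms(1), of i j] ideal_prod.prod[of "h i" I' "h j" J' S] m_closed
      by metis
  next
    case (sum s t)
    then show ?case
      using ring_hom_add[OF assms(1), of s t] ideal_prod.sum[of "h s" S I' J' "h t"] a_closed by metis
  qed
  then show "h x \<in> I' \<cdot>\<^bsub>S\<^esub> J'" ..
qed

lemma ideal_prod_image_supset:
  assumes "h \<in> ring_hom R S" "I \<subseteq> carrier R" "J \<subseteq> carrier R" "ring R"
    and "I' \<subseteq> h ` I" "J' \<subseteq> h ` J"
  shows "I' \<cdot>\<^bsub>S\<^esub> J' \<subseteq> h ` (I \<cdot>\<^bsub>R\<^esub> J)"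
proof
  interpret ring R by fact
  fix x assume "x \<in> I' \<cdot>\<^bsub>S\<^esub> J'"
  then have "\<exists>y. y \<in> carrier R \<and> y \<in> I \<cdot>\<^bsub>R\<^esub> J \<and> x = h y"
  proof (induction rule: ideal_prod.induct)
    case (prod i j)
    then obtain i' j' where "i' \<in> I" "j' \<in> J" "i = h i'" "j = h j'" using assms by blast
    moreover from this have "i' \<in> carrier R" "j' \<in> carrier R" using assms by blast+
    ultimately show ?case
      using ring_hom_mult[OF assms(1), of i' j'] ideal_prod.prod[of i' I j' J R] m_closed by metis
  next
    case (sum s t)
    then show ?case by (metis a_closed ideal_prod.sum ring_hom_add[OF assms(1)])
  qed
  then show "x \<in> h ` (I \<cdot>\<^bsub>R\<^esub> J)" by blast
qed

lemma ideal_power_image_subset: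
  assumes "h \<in> ring_hom R S" "ideal I R" "h ` I \<subseteq> I'"
  shows "h ` ideal_power R I m \<subseteq> ideal_power S I' m"
proof (induction m)
  case 0
  then show ?case using ring_hom_closed[OF assms(1)] by (auto simp: ideal_power_0)
next
  case (Suc m)
  interpret ideal I R by fact
  show ?case unfolding ideal_power_Suc
    by (rule ideal_prod_image_subset[OF assms(1) _ a_subset ring_axioms Suc assms(3)])
      (rule ideal.axioms(1)[OF ideal_power_ideal[OF assms(2)], THEN additive_subgroup.a_subset])
qed

text \<open>Preimages are chosen factor by factor. Surjectivity of \<open>h\<close> starts the
  induction, the zeroth power being the whole ring.\<close>

lemma ideal_power_image_supset:
  assumes "h \<in> ring_hom R S" "ideal I R" "I' \<subseteq> h ` I" "carrier S \<subseteq> h ` carrier R"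
  shows "ideal_power S I' m \<subseteq> h ` ideal_power R I m"
proof (induction m)
  case 0
  then show ?case using assms(4) by (simp add: ideal_power_0)
next
  case (Suc m)
  interpret ideal I R by fact
  show ?case unfolding ideal_power_Suc
    by (rule ideal_prod_image_supset[OF assms(1) _ a_subset ring_axioms Suc assms(3)])
      (rule ideal.axioms(1)[OF ideal_power_ideal[OF assms(2)], THEN additive_subgroup.a_subset])
qed

lemma ideal_inter_kernel:
  assumes "ring R" "ring S" "h \<in> ring_hom R S" "ideal I R"
  shows "ideal {y \<in> I. h y = \<zero>\<^bsub>S\<^esub>} R"
proof -
  interpret ring_hom_ring R S h using assms by (intro ring_hom_ringI2)
  have "{y \<in> I. h y = \<zero>\<^bsub>S\<^esub>} = I \<inter> a_kernel R S h"
    using ideal.Icarr[OF assms(4)] unfolding a_kernel_def' by blast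
  then show ?thesis using R.i_intersect[OF assms(4) kernel_is_ideal] by simp
qed

section \<open>Simplicial ideals and the decalage\<close>

text \<open>Separated from \<open>simplicial_ideal\<close> because the correction of chains in
  \<open>moore_correction\<close> works for levelwise additive subgroups with this property.\<close>

definition simplicial_stable :: "'a simplicial \<Rightarrow> (nat \<Rightarrow> 'a set) \<Rightarrow> bool"
  where "simplicial_stable A Q \<longleftrightarrow>
    (\<forall>n. \<forall>i\<le>Suc n. face A n i ` Q (Suc n) \<subseteq> Q n) \<and> (\<forall>n. \<forall>i\<le>n. degen A n i ` Q n \<subseteq> Q (Suc n))"

lemma simplicial_stableD:
  assumes "simplicial_stable A Q"
  shows "i \<le> Suc n \<Longrightarrow> x \<in> Q (Suc n) \<Longrightarrow> face A n i x \<in> Q n"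
    and "i \<le> n \<Longrightarrow> x \<in> Q n \<Longrightarrow> degen A n i x \<in> Q (Suc n)"
  using assms by (auto simp: simplicial_stable_def image_subset_iff)

definition simplicial_ideal :: "'a simplicial \<Rightarrow> (nat \<Rightarrow> 'a set) \<Rightarrow> bool"
  where "simplicial_ideal A I \<longleftrightarrow> (\<forall>n. ideal (I n) (level A n)) \<and> simplicial_stable A I"

text \<open>This is \<open>\<pi>\<^sub>0(I) = 0\<close> for \<open>I\<close> viewed as a simplicial
  abelian group: the Moore differential from degree 1 onto \<open>I 0\<close> is surjective.\<close>

definition pi0_trivial :: "'a simplicial \<Rightarrow> (nat \<Rightarrow> 'a set) \<Rightarrow> bool"
  where "pi0_trivial A I \<longleftrightarrow>
    (\<forall>v\<in>I 0. \<exists>w\<in>I 1. face A 0 1 w = \<zero>\<^bsub>level A 0\<^esub> \<and> face A 0 0 w = v)"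

lemma simplicial_idealD:
  assumes "simplicial_ideal A I"
  shows "ideal (I n) (level A n)"
    and "i \<le> Suc n \<Longrightarrow> x \<in> I (Suc n) \<Longrightarrow> face A n i x \<in> I n"
    and "i \<le> n \<Longrightarrow> x \<in> I n \<Longrightarrow> degen A n i x \<in> I (Suc n)"
    and "x \<in> I n \<Longrightarrow> x \<in> carrier (level A n)"
proof -
  have *: "ideal (I n) (level A n)" "simplicial_stable A I" for n
    using assms by (simp_all add: simplicial_ideal_def)
  show "ideal (I n) (level A n)" by (rule *)
  show "i \<le> Suc n \<Longrightarrow> x \<in> I (Suc n) \<Longrightarrow> face A n i x \<in> I n"
    and "i \<le> n \<Longrightarrow> x \<in> I n \<Longrightarrow> degen A n i x \<in> I (Suc n)"
    by (rule simplicial_stableD[OF *(2)]; assumption)+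
  show "x \<in> I n \<Longrightarrow> x \<in> carrier (level A n)" by (rule ideal.Icarr[OF *(1)])
qed

text \<open>The face and degeneracy of index 0 are dropped. The dropped \<open>d_0\<close> becomes a
  simplicial map back to \<open>A\<close>, and the dropped \<open>s_0\<close> is an extra degeneracy
  contracting the decalage onto the initial vertex.\<close>

definition decalage :: "'a simplicial \<Rightarrow> 'a simplicial"
  where "decalage A =
    \<lparr>level = (\<lambda>n. level A (Suc n)),
     face = (\<lambda>n i. face A (Suc n) (Suc i)),
     degen = (\<lambda>n i. degen A (Suc n) (Suc i))\<rparr>"

lemma decalage_simps [simp]:
  "level (decalage A) n = level A (Suc n)"
  "face (decalage A) n i = face A (Suc n) (Suc i)"
  "degen (decalage A) n i = degen A (Suc n) (Suc i)"
  by (simp_all add: decalage_def)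

section \<open>Moore chains and their correction modulo a stable subgroup\<close>

context simplicial_cring
begin

interpretation L: cring "level A n" for n
  by (rule cring_level)

lemma face_ring_hom_ring: "i \<le> Suc n \<Longrightarrow> ring_hom_ring (level A (Suc n)) (level A n) (face A n i)"
  by (intro ring_hom_ringI2 face_hom L.ring_axioms)

lemma face_closed [simp]:
  "i \<le> Suc n \<Longrightarrow> x \<in> carrier (level A (Suc n)) \<Longrightarrow> face A n i x \<in> carrier (level A n)"
  by (rule ring_hom_closed[OF face_hom])

lemma degen_closed [simp]:
  "i \<le> n \<Longrightarrow> x \<in> carrier (level A n) \<Longrightarrow> degen A n i x \<in> carrier (level A (Suc n))"
  by (rule ring_hom_closed[OF degen_hom])

lemma face_zero [simp]: "i \<le> Suc n \<Longrightarrow> face A n i \<zero>\<^bsub>level A (Suc n)\<^esub> = \<zero>\<^bsub>level A n\<^esub>"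
  by (rule ring_hom_zero[OF face_hom L.ring_axioms L.ring_axioms])

lemma degen_zero [simp]: "i \<le> n \<Longrightarrow> degen A n i \<zero>\<^bsub>level A n\<^esub> = \<zero>\<^bsub>level A (Suc n)\<^esub>"
  by (rule ring_hom_zero[OF degen_hom L.ring_axioms L.ring_axioms])

lemma face_add:
  assumes "i \<le> Suc n" "x \<in> carrier (level A (Suc n))" "y \<in> carrier (level A (Suc n))"
  shows "face A n i (x \<oplus>\<^bsub>level A (Suc n)\<^esub> y) = face A n i x \<oplus>\<^bsub>level A n\<^esub> face A n i y"
  by (rule ring_hom_add[OF face_hom[OF assms(1)] assms(2,3)])

lemma face_minus:
  assumes "i \<le> Suc n" "x \<in> carrier (level A (Suc n))" "y \<in> carrier (level A (Suc n))"
  shows "face A n i (x \<ominus>\<^bsub>level A (Suc n)\<^esub> y) = face A n i x \<ominus>\<^bsub>level A n\<^esub> face A n i y"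
proof -
  interpret ring_hom_ring "level A (Suc n)" "level A n" "face A n i"
    by (rule face_ring_hom_ring[OF assms(1)])
  show ?thesis using assms by (simp add: a_minus_def)
qed

lemma moore_carrier: "x \<in> moore A n \<Longrightarrow> x \<in> carrier (level A n)"
  by (cases n) auto

lemma moore_SucD:
  assumes "x \<in> moore A (Suc n)"
  shows "x \<in> carrier (level A (Suc n))"
    and "1 \<le> i \<Longrightarrow> i \<le> Suc n \<Longrightarrow> face A n i x = \<zero>\<^bsub>level A n\<^esub>"
  using assms by auto

lemma moore_cycles_moore: "x \<in> moore_cycles A n \<Longrightarrow> x \<in> moore A n"
  by (cases n) auto

text \<open>By \<open>d_i d_0 = d_0 d_(i+1)\<close>, every face of \<open>d_0 x\<close> factors
  through a face of \<open>x\<close> of positive index, which vanishes.\<close>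

lemma moore_face_cycle:
  assumes "x \<in> moore A (Suc n)"
  shows "face A n 0 x \<in> moore_cycles A n"
proof (cases n)
  case 0
  then show ?thesis using assms by simp
next
  case (Suc k)
  have "face A k i (face A n 0 x) = \<zero>\<^bsub>level A k\<^esub>" if "i \<le> Suc k" for i
  proof -
    have x: "x \<in> carrier (level A (Suc (Suc k)))" "face A (Suc k) (Suc i) x = \<zero>\<^bsub>level A (Suc k)\<^esub>"
      using moore_SucD[OF assms] that unfolding Suc by simp_all
    show ?thesis using face_face[OF x(1), of 0 "Suc i"] that x(2) unfolding Suc by simp
  qed
  then show ?thesis using Suc moore_SucD(1)[OF assms] by simp
qed

text \<open>A chain that is normalised modulo \<open>Q\<close> becomes normalised after subtracting
  an element of \<open>Q\<close>. The positive faces are killed from the top index downwards, each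
  by a degeneracy of that face, which stays in \<open>Q\<close> by stability.\<close>

lemma moore_correction:
  assumes Q: "simplicial_stable A Q" "\<And>n. additive_subgroup (Q n) (level A n)"
    and y: "y \<in> carrier (level A (Suc n))" "\<And>i. 1 \<le> i \<Longrightarrow> i \<le> Suc n \<Longrightarrow> face A n i y \<in> Q n"
  shows "\<exists>q\<in>Q (Suc n). y \<ominus>\<^bsub>level A (Suc n)\<^esub> q \<in> moore A (Suc n)"
proof -
  have Qc: "q \<in> carrier (level A l)" if "q \<in> Q l" for q l
    using additive_subgroup.a_Hcarr[OF Q(2) that] .
  \<comment> \<open>The induction is on the number \<open>k\<close> of top faces already
    killed.\<close>
  have "\<exists>q\<in>Q (Suc n). \<forall>i. Suc n - k < i \<longrightarrow> i \<le> Suc n \<longrightarrow>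
      face A n i (y \<ominus>\<^bsub>level A (Suc n)\<^esub> q) = \<zero>\<^bsub>level A n\<^esub>" if "k \<le> Suc n" for k
    using that
  proof (induction k)
    case 0
    then show ?case using additive_subgroup.zero_closed[OF Q(2)] by (intro bexI) auto
  next
    case (Suc k)
    then obtain q where q: "q \<in> Q (Suc n)"
      and qi: "\<And>i. Suc n - k < i \<Longrightarrow> i \<le> Suc n \<Longrightarrow>
        face A n i (y \<ominus>\<^bsub>level A (Suc n)\<^esub> q) = \<zero>\<^bsub>level A n\<^esub>" by auto
    define i0 where "i0 = Suc n - Suc k"
    define y' where "y' = y \<ominus>\<^bsub>level A (Suc n)\<^esub> q"
    \<comment> \<open>The element \<open>s_i0 d_(i0+1) y'\<close> has the same face of index
      \<open>i0 + 1\<close> as \<open>y'\<close>, since \<open>d_(i0+1) s_i0\<close> is the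
      identity.\<close>
    define t where "t = degen A n i0 (face A n (Suc i0) y')"
    have i0: "i0 \<le> n" "Suc n - k = Suc i0" using Suc.prems by (auto simp: i0_def)
    have y': "y' \<in> carrier (level A (Suc n))" using y Qc[OF q] by (simp add: y'_def)
    have "face A n (Suc i0) y' \<in> Q n"
    proof -
      have "face A n (Suc i0) q \<in> Q n" using simplicial_stableD(1)[OF Q(1)] q i0 by simp
      moreover have "face A n (Suc i0) y \<in> Q n" using y(2) i0 by simp
      moreover have "face A n (Suc i0) y' = face A n (Suc i0) y \<ominus>\<^bsub>level A n\<^esub> face A n (Suc i0) q"
        unfolding y'_def using i0 y Qc[OF q] by (intro face_minus) auto
      ultimately show ?thesis
        using additive_subgroup.a_closed[OF Q(2)] additive_subgroup.a_inv_closed[OF Q(2)]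
          L.abelian_group_axioms by (simp add: a_minus_def)
    qed
    then have t: "t \<in> Q (Suc n)" using simplicial_stableD(2)[OF Q(1)] i0 by (simp add: t_def)
    have "face A n i (y \<ominus>\<^bsub>level A (Suc n)\<^esub> (q \<oplus>\<^bsub>level A (Suc n)\<^esub> t)) = \<zero>\<^bsub>level A n\<^esub>"
      if i: "Suc i0 \<le> i" "i \<le> Suc n" for i
    proof -
      have "y \<ominus>\<^bsub>level A (Suc n)\<^esub> (q \<oplus>\<^bsub>level A (Suc n)\<^esub> t) = y' \<ominus>\<^bsub>level A (Suc n)\<^esub> t"
        using y(1) Qc[OF q] Qc[OF t] unfolding y'_def by algebra
      then have eq: "face A n i (y \<ominus>\<^bsub>level A (Suc n)\<^esub> (q \<oplus>\<^bsub>level A (Suc n)\<^esub> t)) =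
          face A n i y' \<ominus>\<^bsub>level A n\<^esub> face A n i t"
        using face_minus[OF i(2) y' Qc[OF t]] by simp
      have fy: "face A n (Suc i0) y' \<in> carrier (level A n)" using y' i0 by simp
      show ?thesis
      proof (cases "i = Suc i0")
        case True
        have "face A n i t = face A n i y'"
          unfolding t_def True using face_degen_same[OF fy i0(1)] by simp
        then show ?thesis using eq fy True by simp
      next
        case False
        then obtain n' where n': "n = Suc n'" using i by (cases n) auto
        \<comment> \<open>Faces killed earlier stay zero:
          \<open>d_i s_i0 d_(i0+1) y' = s_i0 d_(i0+1) d_i y'\<close> for \<open>i > i0 + 1\<close>,
          and \<open>d_i y' = 0\<close>.\<close>
        have "face A n i t = degen A n' i0 (face A n' (i - 1) (face A n (Suc i0) y'))"
          unfolding t_def using face_degen_greater[of _ n' i0 i] fy i False n' by simp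
        also have "face A n' (i - 1) (face A n (Suc i0) y') = face A n' (Suc i0) (face A n i y')"
          using face_face[of y' n' "Suc i0" i] y' i False n' by simp
        also have "face A n i y' = \<zero>\<^bsub>level A n\<^esub>"
          using qi[of i] i False i0 by (simp add: y'_def)
        finally have "face A n i t = \<zero>\<^bsub>level A n\<^esub>" "face A n i y' = \<zero>\<^bsub>level A n\<^esub>"
          using qi[of i] i False i0 n' by (simp_all add: y'_def)
        then show ?thesis using eq by simp
      qed
    qed
    moreover have "q \<oplus>\<^bsub>level A (Suc n)\<^esub> t \<in> Q (Suc n)"
      using q t additive_subgroup.a_closed[OF Q(2)] by blast
    ultimately show ?case unfolding i0_def[symmetric] Suc_le_eq by (intro bexI) auto
  qed
  from this[of "Suc n"] obtain q where q: "q \<in> Q (Suc n)"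
    and "\<And>i. 1 \<le> i \<Longrightarrow> i \<le> Suc n \<Longrightarrow>
      face A n i (y \<ominus>\<^bsub>level A (Suc n)\<^esub> q) = \<zero>\<^bsub>level A n\<^esub>" by auto
  moreover from this have "y \<ominus>\<^bsub>level A (Suc n)\<^esub> q \<in> carrier (level A (Suc n))"
    using y(1) Qc by simp
  ultimately have "y \<ominus>\<^bsub>level A (Suc n)\<^esub> q \<in> moore A (Suc n)" by simp
  then show ?thesis using q by blast
qed

section \<open>The initial vertex map\<close>

lemma vertex_hom: "vertex A n \<in> ring_hom (level A n) (level A 0)"
proof (induction n)
  case 0
  show ?case by (simp add: ring_hom_def)
next
  case (Suc n)
  have "vertex A (Suc n) = vertex A n \<circ> face A n (Suc n)" by (simp add: fun_eq_iff)
  then show ?case using ring_hom_trans[OF face_hom[of "Suc n" n] Suc] by (simp only: order_refl)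
qed

text \<open>The composite \<open>d_1 d_2 ... d_n\<close> reads off the initial vertex, which no face
  of positive index removes. In the induction the face is moved past the top face.\<close>

lemma vertex_face:
  assumes "x \<in> carrier (level A (Suc n))" "1 \<le> i" "i \<le> Suc n"
  shows "vertex A n (face A n i x) = vertex A (Suc n) x"
  using assms
proof (induction n arbitrary: x i)
  case 0
  then have "i = 1" by simp
  then show ?case by simp
next
  case (Suc n)
  show ?case
  proof (cases "i = Suc (Suc n)")
    case False
    then have "i < Suc (Suc n)" using Suc.prems by simp
    then have "vertex A (Suc n) (face A (Suc n) i x)
        = vertex A n (face A n i (face A (Suc n) (Suc (Suc n)) x))"
      using face_face[OF Suc.prems(1), of i "Suc (Suc n)"] by simp
    also have "\<dots> = vertex A (Suc n) (face A (Suc n) (Suc (Suc n)) x)"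
      using Suc.prems False by (intro Suc.IH) auto
    finally show ?thesis by simp
  qed simp
qed

lemma vertex_degen:
  assumes "x \<in> carrier (level A n)" "i \<le> n"
  shows "vertex A (Suc n) (degen A n i x) = vertex A n x"
  using vertex_face[of "degen A n i x" n "Suc i"] assms face_degen_same[OF assms, of "Suc i"] by simp

section \<open>Simplicial ideals of a simplicial ring and of its decalage\<close>

lemma simplicial_ideal_prod:
  assumes "simplicial_ideal A I" "simplicial_ideal A N"
  shows "simplicial_ideal A (\<lambda>n. I n \<cdot>\<^bsub>level A n\<^esub> N n)"
  unfolding simplicial_ideal_def simplicial_stable_def
proof (intro conjI allI impI)
  note sub = additive_subgroup.a_subset[OF ideal.axioms(1)[OF simplicial_idealD(1)]]
  show "ideal (I n \<cdot>\<^bsub>level A n\<^esub> N n) (level A n)" for n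
    by (intro L.ideal_prod_is_ideal simplicial_idealD(1) assms)
  show "face A n i ` (I (Suc n) \<cdot>\<^bsub>level A (Suc n)\<^esub> N (Suc n)) \<subseteq> I n \<cdot>\<^bsub>level A n\<^esub> N n"
    if "i \<le> Suc n" for n i
    by (rule ideal_prod_image_subset[OF face_hom[OF that] sub[OF assms(1)] sub[OF assms(2)] L.ring_axioms])
      (use that in \<open>auto intro: simplicial_idealD(2)[OF assms(1)] simplicial_idealD(2)[OF assms(2)]\<close>)
  show "degen A n i ` (I n \<cdot>\<^bsub>level A n\<^esub> N n) \<subseteq> I (Suc n) \<cdot>\<^bsub>level A (Suc n)\<^esub> N (Suc n)"
    if "i \<le> n" for n i
    by (rule ideal_prod_image_subset[OF degen_hom[OF that] sub[OF assms(1)] sub[OF assms(2)] L.ring_axioms])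
      (use that in \<open>auto intro: simplicial_idealD(3)[OF assms(1)] simplicial_idealD(3)[OF assms(2)]\<close>)
qed

lemma simplicial_ideal_power:
  assumes "simplicial_ideal A I"
  shows "simplicial_ideal A (\<lambda>n. ideal_power (level A n) (I n) m)"
proof (induction m)
  case 0
  show ?case
    by (auto simp: ideal_power_0 simplicial_ideal_def simplicial_stable_def L.oneideal)
next
  case (Suc m)
  show ?case using simplicial_ideal_prod[OF Suc assms] by (simp add: ideal_power_Suc)
qed

lemma simplicial_cring_decalage: "simplicial_cring (decalage A)"
proof (intro simplicial_cring.intro, unfold decalage_simps)
  fix n i j :: nat and x
  show "cring (level A (Suc n))" by (rule cring_level)
  show "face A (Suc n) (Suc i) \<in> ring_hom (level A (Suc (Suc n))) (level A (Suc n))" if "i \<le> Suc n"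
    using that by (intro face_hom) simp
  show "degen A (Suc n) (Suc i) \<in> ring_hom (level A (Suc n)) (level A (Suc (Suc n)))" if "i \<le> n"
    using that by (intro degen_hom) simp
  show "face A (Suc n) (Suc i) (face A (Suc (Suc n)) (Suc j) x)
      = face A (Suc n) (Suc (j - 1)) (face A (Suc (Suc n)) (Suc i) x)"
    if "x \<in> carrier (level A (Suc (Suc (Suc n))))" "i < j" "j \<le> Suc (Suc n)"
    using face_face[OF that(1), of "Suc i" "Suc j"] that(2,3) by simp
  show "degen A (Suc (Suc n)) (Suc i) (degen A (Suc n) (Suc j) x)
      = degen A (Suc (Suc n)) (Suc (Suc j)) (degen A (Suc n) (Suc i) x)"
    if "x \<in> carrier (level A (Suc n))" "i \<le> j" "j \<le> n"
    using degen_degen[OF that(1), of "Suc i" "Suc j"] that(2,3) by simp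
  show "face A (Suc (Suc n)) (Suc i) (degen A (Suc (Suc n)) (Suc j) x)
      = degen A (Suc n) (Suc (j - 1)) (face A (Suc n) (Suc i) x)"
    if "x \<in> carrier (level A (Suc (Suc n)))" "i < j" "j \<le> Suc n"
    using face_degen_less[OF that(1), of "Suc i" "Suc j"] that(2,3) by simp
  show "face A (Suc n) (Suc i) (degen A (Suc n) (Suc j) x) = x"
    if "x \<in> carrier (level A (Suc n))" "j \<le> n" "i = j \<or> i = Suc j"
    using face_degen_same[OF that(1), of "Suc j" "Suc i"] that(2,3) by simp
  show "face A (Suc (Suc n)) (Suc i) (degen A (Suc (Suc n)) (Suc j) x)
      = degen A (Suc n) (Suc j) (face A (Suc n) (Suc (i - 1)) x)"
    if "x \<in> carrier (level A (Suc (Suc n)))" "Suc j < i" "i \<le> Suc (Suc n)"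
    using face_degen_greater[OF that(1), of "Suc j" "Suc i"] that(2,3) by simp
qed

lemma simplicial_ideal_decalage:
  assumes "simplicial_ideal A N"
  shows "simplicial_ideal (decalage A) (\<lambda>n. N (Suc n))"
  unfolding simplicial_ideal_def simplicial_stable_def decalage_simps
  by (intro conjI allI impI image_subsetI simplicial_idealD[OF assms]) simp_all

text \<open>The identities \<open>d_0 d_(i+1) = d_i d_0\<close> and
  \<open>d_0 s_(i+1) = s_i d_0\<close> make \<open>d_0\<close> a simplicial map from the decalage to
  \<open>A\<close>, so its kernel is stable.\<close>

lemma simplicial_ideal_ker_face0:
  assumes "simplicial_ideal (decalage A) N"
  shows "simplicial_ideal (decalage A) (\<lambda>n. {x \<in> N n. face A n 0 x = \<zero>\<^bsub>level A n\<^esub>})"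
proof -
  note N = simplicial_idealD[OF assms, simplified]
  show ?thesis
    unfolding simplicial_ideal_def simplicial_stable_def decalage_simps
  proof (intro conjI allI impI subsetI)
    show "ideal {x \<in> N n. face A n 0 x = \<zero>\<^bsub>level A n\<^esub>} (level A (Suc n))" for n
      by (rule ideal_inter_kernel[OF L.ring_axioms L.ring_axioms face_hom N(1)]) simp
  next
    fix n i y assume i: "i \<le> Suc n"
      and "y \<in> face A (Suc n) (Suc i) ` {x \<in> N (Suc n). face A (Suc n) 0 x = \<zero>\<^bsub>level A (Suc n)\<^esub>}"
    then obtain x where x: "y = face A (Suc n) (Suc i) x" "x \<in> N (Suc n)"
      "face A (Suc n) 0 x = \<zero>\<^bsub>level A (Suc n)\<^esub>" by blast
    have "face A n 0 y = face A n i (face A (Suc n) 0 x)"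
      using face_face[of x n 0 "Suc i"] N(4)[OF x(2)] i x(1) by simp
    then show "y \<in> {x \<in> N n. face A n 0 x = \<zero>\<^bsub>level A n\<^esub>}" using x i N(2) by simp
  next
    fix n i y assume i: "i \<le> n"
      and "y \<in> degen A (Suc n) (Suc i) ` {x \<in> N n. face A n 0 x = \<zero>\<^bsub>level A n\<^esub>}"
    then obtain x where x: "y = degen A (Suc n) (Suc i) x" "x \<in> N n"
      "face A n 0 x = \<zero>\<^bsub>level A n\<^esub>" by blast
    have "face A (Suc n) 0 y = degen A n i (face A n 0 x)"
      using face_degen_less[of x n 0 "Suc i"] N(4)[OF x(2)] i x(1) by simp
    then show "y \<in> {x \<in> N (Suc n). face A (Suc n) 0 x = \<zero>\<^bsub>level A (Suc n)\<^esub>}"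
      using x i N(3) by simp
  qed
qed

text \<open>Decalage faces have positive index in \<open>A\<close>, so they preserve the initial
  vertex, as do degeneracies.\<close>

lemma simplicial_ideal_ker_vertex:
  assumes "simplicial_ideal A I"
  shows "simplicial_ideal (decalage A) (\<lambda>n. {y \<in> I (Suc n). vertex A (Suc n) y = \<zero>\<^bsub>level A 0\<^esub>})"
proof -
  note I = simplicial_idealD[OF assms]
  show ?thesis
    unfolding simplicial_ideal_def simplicial_stable_def decalage_simps
  proof (intro conjI allI impI image_subsetI CollectI)
    show "ideal {y \<in> I (Suc n). vertex A (Suc n) y = \<zero>\<^bsub>level A 0\<^esub>} (level A (Suc n))" for n
      by (rule ideal_inter_kernel[OF L.ring_axioms L.ring_axioms vertex_hom I(1)])
  next
    fix n i x assume i: "i \<le> Suc n" and "x \<in> {y \<in> I (Suc (Suc n)). vertex A (Suc (Suc n)) y = \<zero>\<^bsub>level A 0\<^esub>}"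
    then have x: "x \<in> I (Suc (Suc n))" "vertex A (Suc (Suc n)) x = \<zero>\<^bsub>level A 0\<^esub>" by blast+
    show "face A (Suc n) (Suc i) x \<in> I (Suc n)" using I(2)[OF _ x(1)] i by simp
    show "vertex A (Suc n) (face A (Suc n) (Suc i) x) = \<zero>\<^bsub>level A 0\<^esub>"
      using vertex_face[OF I(4)[OF x(1)], of "Suc i"] x(2) i by simp
  next
    fix n i x assume i: "i \<le> n" and "x \<in> {y \<in> I (Suc n). vertex A (Suc n) y = \<zero>\<^bsub>level A 0\<^esub>}"
    then have x: "x \<in> I (Suc n)" "vertex A (Suc n) x = \<zero>\<^bsub>level A 0\<^esub>" by blast+
    show "degen A (Suc n) (Suc i) x \<in> I (Suc (Suc n))" using I(3)[OF _ x(1)] i by simp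
    show "vertex A (Suc (Suc n)) (degen A (Suc n) (Suc i) x) = \<zero>\<^bsub>level A 0\<^esub>"
      using vertex_degen[OF I(4)[OF x(1)], of "Suc i"] x(2) i by simp
  qed
qed

text \<open>The extra degeneracy supplies the bounding chain: \<open>d_1 s_0 v = v\<close>, while
  \<open>d_2 s_0 v = s_0 d_1 v = 0\<close> because \<open>v\<close> has initial vertex zero.\<close>

lemma pi0_trivial_ker_vertex:
  assumes "simplicial_ideal A I"
  shows "pi0_trivial (decalage A) (\<lambda>n. {y \<in> I (Suc n). vertex A (Suc n) y = \<zero>\<^bsub>level A 0\<^esub>})"
  unfolding pi0_trivial_def
proof
  note I = simplicial_idealD[OF assms]
  fix v assume "v \<in> {y \<in> I (Suc 0). vertex A (Suc 0) y = \<zero>\<^bsub>level A 0\<^esub>}"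
  then have v: "v \<in> I 1" "v \<in> carrier (level A 1)" "face A 0 1 v = \<zero>\<^bsub>level A 0\<^esub>" using I(4) by auto
  show "\<exists>w\<in>{y \<in> I (Suc 1). vertex A (Suc 1) y = \<zero>\<^bsub>level A 0\<^esub>}.
      face (decalage A) 0 1 w = \<zero>\<^bsub>level (decalage A) 0\<^esub> \<and> face (decalage A) 0 0 w = v"
  proof (intro bexI conjI)
    show "face (decalage A) 0 0 (degen A 1 0 v) = v"
      using face_degen_same[of v 1 0 1] v by simp
    show "face (decalage A) 0 1 (degen A 1 0 v) = \<zero>\<^bsub>level (decalage A) 0\<^esub>"
      using face_degen_greater[of v 0 0 2] v by (simp add: numeral_2_eq_2)
    show "degen A 1 0 v \<in> {y \<in> I (Suc 1). vertex A (Suc 1) y = \<zero>\<^bsub>level A 0\<^esub>}"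
      using v I(3)[of 0 1 v] vertex_degen[of v 1 0] by simp
  qed
qed

text \<open>In degree 0 this is the vanishing of \<open>\<pi>\<^sub>0(I)\<close>. In higher degrees
  an element splits into a degeneracy of its top face, lifted by induction, and a remainder with
  zero top face, lifted by \<open>s_0\<close>.\<close>

lemma face0_ker_vertex_surj:
  assumes "simplicial_ideal A I" "pi0_trivial A I"
  shows "I n \<subseteq> face A n 0 ` {y \<in> I (Suc n). vertex A (Suc n) y = \<zero>\<^bsub>level A 0\<^esub>}"
proof (induction n)
  case 0
  show ?case
  proof
    fix v assume "v \<in> I 0"
    then obtain w where "w \<in> I 1" "face A 0 1 w = \<zero>\<^bsub>level A 0\<^esub>" "face A 0 0 w = v"
      using assms(2) by (auto simp: pi0_trivial_def)
    then show "v \<in> face A 0 0 ` {y \<in> I (Suc 0). vertex A (Suc 0) y = \<zero>\<^bsub>level A 0\<^esub>}"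
      by (intro image_eqI[of _ _ w]) auto
  qed
next
  case (Suc n)
  note I = simplicial_idealD[OF assms(1)]
  show ?case
  proof
    fix x assume x: "x \<in> I (Suc n)"
    have xc: "x \<in> carrier (level A (Suc n))" by (rule I(4)[OF x])
    define x1 where "x1 = face A n (Suc n) x"
    have x1: "x1 \<in> I n" using I(2) x by (simp add: x1_def)
    then obtain y1 where y1: "y1 \<in> I (Suc n)" "vertex A (Suc n) y1 = \<zero>\<^bsub>level A 0\<^esub>"
      "face A n 0 y1 = x1" using Suc by blast
    \<comment> \<open>Subtracting \<open>s_n d_(n+1) x\<close> kills the top face, and with it the
      initial vertex, which is computed through the top face.\<close>
    define x' where "x' = x \<ominus>\<^bsub>level A (Suc n)\<^esub> degen A n n x1"
    have x': "x' \<in> I (Suc n)"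
      unfolding x'_def using I(1) x I(3)[OF order_refl x1] by (rule L.ideal_minus_closed)
    have x'c: "x' \<in> carrier (level A (Suc n))" by (rule I(4)[OF x'])
    have x1c: "x1 \<in> carrier (level A n)" by (rule I(4)[OF x1])
    have "face A n (Suc n) x' = x1 \<ominus>\<^bsub>level A n\<^esub> x1"
      unfolding x'_def using xc x1c by (simp add: face_minus face_degen_same x1_def[symmetric])
    then have d: "face A n (Suc n) x' = \<zero>\<^bsub>level A n\<^esub>" using x1c by simp
    \<comment> \<open>Under \<open>d_0\<close> the first summand gives
      \<open>s_n d_0 y1 = s_n x1\<close> and the second gives \<open>x'\<close>; both summands have
      initial vertex zero.\<close>
    define y where "y = degen A (Suc n) (Suc n) y1 \<oplus>\<^bsub>level A (Suc (Suc n))\<^esub> degen A (Suc n) 0 x'"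
    have y1c: "y1 \<in> carrier (level A (Suc n))" by (rule I(4)[OF y1(1)])
    have yI: "y \<in> I (Suc (Suc n))"
      unfolding y_def using I(3) y1 x'
      by (intro additive_subgroup.a_closed[OF ideal.axioms(1)[OF I(1)]]) auto
    have "face A (Suc n) 0 (degen A (Suc n) (Suc n) y1) = degen A n n x1"
      using face_degen_less[OF y1c, of 0 "Suc n"] y1 by simp
    moreover have "face A (Suc n) 0 (degen A (Suc n) 0 x') = x'"
      using face_degen_same[OF x'c, of 0 0] by simp
    ultimately have "face A (Suc n) 0 y = degen A n n x1 \<oplus>\<^bsub>level A (Suc n)\<^esub> x'"
      unfolding y_def using y1c x'c by (simp add: face_add)
    also have "\<dots> = x"
      using degen_closed[OF order_refl x1c] xc unfolding x'_def by algebra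
    finally have fy: "face A (Suc n) 0 y = x" .
    have "vertex A (Suc (Suc n)) y = vertex A (Suc (Suc n)) (degen A (Suc n) (Suc n) y1)
        \<oplus>\<^bsub>level A 0\<^esub> vertex A (Suc (Suc n)) (degen A (Suc n) 0 x')"
      unfolding y_def by (rule ring_hom_add[OF vertex_hom]) (use y1c x'c in auto)
    also have "\<dots> = \<zero>\<^bsub>level A 0\<^esub>"
      using vertex_degen[OF y1c, of "Suc n"] vertex_degen[OF x'c, of 0] y1(2) d
        ring_hom_zero[OF vertex_hom L.ring_axioms L.ring_axioms, of n]
      by simp
    finally show "x \<in> face A (Suc n) 0 ` {y \<in> I (Suc (Suc n)). vertex A (Suc (Suc n)) y = \<zero>\<^bsub>level A 0\<^esub>}"
      using yI fy by blast
  qed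
qed

end

section \<open>Lifting products of ideals along \<open>d_0\<close>\<close>

context simplicial_cring
begin

interpretation L: cring "level A n" for n
  by (rule cring_level)

text \<open>The ideal \<open>K\<close> of the decalage; the index is that of the decalage, so degree
  \<open>n\<close> lies in \<open>level A (Suc n)\<close>.\<close>

definition ker_vertex :: "(nat \<Rightarrow> 'a set) \<Rightarrow> nat \<Rightarrow> 'a set"
  where "ker_vertex I n = {y \<in> I (Suc n). vertex A (Suc n) y = \<zero>\<^bsub>level A 0\<^esub>}"

text \<open>Each factor lifts separately: \<open>I\<close> lifts to \<open>K\<close> because
  \<open>\<pi>\<^sub>0(I)\<close> vanishes, and \<open>N\<close> lifts through the section
  \<open>s_0\<close> of \<open>d_0\<close>.\<close>

lemma product_lift:
  assumes I: "simplicial_ideal A I" and N: "simplicial_ideal A N" and pi0: "pi0_trivial A I"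
    and z: "z \<in> ideal_power (level A n) (I n) m \<cdot>\<^bsub>level A n\<^esub> N n"
  obtains y where "face A n 0 y = z"
    "y \<in> ideal_power (level A (Suc n)) (ker_vertex I n) m \<cdot>\<^bsub>level A (Suc n)\<^esub> N (Suc n)"
proof -
  have K: "simplicial_ideal (decalage A) (ker_vertex I)"
    unfolding ker_vertex_def by (rule simplicial_ideal_ker_vertex[OF I])
  have Kn: "ideal (ker_vertex I n) (level A (Suc n))"
    using simplicial_idealD(1)[OF K] by simp
  have N0: "N n \<subseteq> face A n 0 ` N (Suc n)"
  proof
    fix x assume x: "x \<in> N n"
    show "x \<in> face A n 0 ` N (Suc n)"
      using face_degen_same[OF simplicial_idealD(4)[OF N x], of 0 0] simplicial_idealD(3)[OF N _ x, of 0]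
      by (intro image_eqI[of _ _ "degen A n 0 x"]) simp_all
  qed
  have c0: "carrier (level A n) \<subseteq> face A n 0 ` carrier (level A (Suc n))"
  proof
    fix x assume x: "x \<in> carrier (level A n)"
    show "x \<in> face A n 0 ` carrier (level A (Suc n))"
      using face_degen_same[OF x, of 0 0] x by (intro image_eqI[of _ _ "degen A n 0 x"]) simp_all
  qed
  have face0: "face A n 0 \<in> ring_hom (level A (Suc n)) (level A n)" by (rule face_hom) simp
  have "ideal_power (level A n) (I n) m \<cdot>\<^bsub>level A n\<^esub> N n \<subseteq>
      face A n 0 ` (ideal_power (level A (Suc n)) (ker_vertex I n) m \<cdot>\<^bsub>level A (Suc n)\<^esub> N (Suc n))"
  proof (rule ideal_prod_image_supset[OF face0 _ _ L.ring_axioms _ N0])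
    show "ideal_power (level A (Suc n)) (ker_vertex I n) m \<subseteq> carrier (level A (Suc n))"
      using ideal.Icarr[OF L.ideal_power_ideal[OF Kn]] by blast
    show "N (Suc n) \<subseteq> carrier (level A (Suc n))" using simplicial_idealD(4)[OF N] by blast
    show "ideal_power (level A n) (I n) m \<subseteq>
        face A n 0 ` ideal_power (level A (Suc n)) (ker_vertex I n) m"
      by (rule ideal_power_image_supset[OF face0 Kn _ c0])
        (unfold ker_vertex_def, rule face0_ker_vertex_surj[OF I pi0])
  qed
  then show ?thesis using z that by blast
qed

lemma ker_vertex_product_subset:
  assumes I: "simplicial_ideal A I" and N: "simplicial_ideal A N" and "m \<le> m'"
  shows "ideal_power (level A (Suc n)) (ker_vertex I n) m' \<cdot>\<^bsub>level A (Suc n)\<^esub> N (Suc n)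
    \<subseteq> ideal_power (level A (Suc n)) (I (Suc n)) m \<cdot>\<^bsub>level A (Suc n)\<^esub> N (Suc n)"
proof (rule ideal_prod_mono[OF _ order_refl])
  have "ideal_power (level A (Suc n)) (ker_vertex I n) m' \<subseteq> ideal_power (level A (Suc n)) (I (Suc n)) m'"
    by (rule ideal_power_mono) (simp add: ker_vertex_def)
  also have "\<dots> \<subseteq> ideal_power (level A (Suc n)) (I (Suc n)) m"
    by (rule L.ideal_power_antimono[OF simplicial_idealD(1)[OF I] assms(3)])
  finally show "ideal_power (level A (Suc n)) (ker_vertex I n) m' \<subseteq>
      ideal_power (level A (Suc n)) (I (Suc n)) m" .
qed

end

text \<open>The second ideal \<open>N\<close> is carried along because cutting \<open>K^m N\<close>
  down to the kernel of \<open>d_0\<close> by Artin--Rees leads to \<open>K^s T\<close>, again a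
  product of a power with another ideal. The variables \<open>A\<close>, \<open>I\<close>,
  \<open>N\<close> and \<open>m\<close> are generalised since the induction hypothesis is applied to
  the decalage.\<close>

lemma pro_acyclic:
  assumes "simplicial_cring A" "\<And>l. noetherian_ring (level A l)"
    and "simplicial_ideal A I" "simplicial_ideal A N" "pi0_trivial A I"
  shows "\<exists>m'. \<forall>z\<in>moore_cycles A n.
    z \<in> ideal_power (level A n) (I n) m' \<cdot>\<^bsub>level A n\<^esub> N n \<longrightarrow>
    (\<exists>u\<in>moore A (Suc n). face A n 0 u = z \<and>
      u \<in> ideal_power (level A (Suc n)) (I (Suc n)) m \<cdot>\<^bsub>level A (Suc n)\<^esub> N (Suc n))"
  using assms
proof (induction n arbitrary: A I N m)
  case (0 A I N m)
  interpret simplicial_cring A by fact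
  interpret L: cring "level A l" for l by (rule cring_level)
  have K: "simplicial_ideal (decalage A) (ker_vertex I)"
    unfolding ker_vertex_def by (rule simplicial_ideal_ker_vertex[OF 0(3)])
  show ?case
  \<comment> \<open>The exponent must be positive so that the lift lies in \<open>K\<close>. An
    element of \<open>K\<close> in degree 0 of the decalage is killed by \<open>d_1\<close>, so it
    is already a Moore chain of \<open>A\<close>.\<close>
  proof (intro exI[of _ "Suc m"] ballI impI)
    fix z assume "z \<in> ideal_power (level A 0) (I 0) (Suc m) \<cdot>\<^bsub>level A 0\<^esub> N 0"
    then obtain y where y: "face A 0 0 y = z"
      "y \<in> ideal_power (level A (Suc 0)) (ker_vertex I 0) (Suc m) \<cdot>\<^bsub>level A (Suc 0)\<^esub> N (Suc 0)"
      by (rule product_lift[OF 0(3,4,5)])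
    have K0: "ideal (ker_vertex I 0) (level A (Suc 0))" using simplicial_idealD(1)[OF K, of 0] by simp
    have "y \<in> ideal_power (level A (Suc 0)) (ker_vertex I 0) (Suc m)"
      using y(2) L.ideal_prod_inter[OF L.ideal_power_ideal[OF K0] simplicial_idealD(1)[OF 0(4)]] by blast
    also have "\<dots> \<subseteq> ideal_power (level A (Suc 0)) (ker_vertex I 0) 1"
      by (rule L.ideal_power_antimono[OF K0]) simp
    finally have "y \<in> ker_vertex I 0" using L.ideal_power_1[OF K0] by simp
    then have "y \<in> moore A (Suc 0)"
      using simplicial_idealD(4)[OF 0(3)] by (auto simp: ker_vertex_def)
    moreover have "y \<in> ideal_power (level A (Suc 0)) (I (Suc 0)) m \<cdot>\<^bsub>level A (Suc 0)\<^esub> N (Suc 0)"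
      using y(2) ker_vertex_product_subset[OF 0(3,4), of m "Suc m" 0] by (blast intro: le_SucI)
    ultimately show "\<exists>u\<in>moore A (Suc 0). face A 0 0 u = z \<and>
      u \<in> ideal_power (level A (Suc 0)) (I (Suc 0)) m \<cdot>\<^bsub>level A (Suc 0)\<^esub> N (Suc 0)"
      using y(1) by blast
  qed
next
  case (Suc n A I N m)
  interpret simplicial_cring A by fact
  interpret L: cring "level A l" for l by (rule cring_level)
  interpret D: simplicial_cring "decalage A" by (rule simplicial_cring_decalage)
  define K where "K = ker_vertex I"
  define T where "T l = {x \<in> N (Suc l). face A l 0 x = \<zero>\<^bsub>level A l\<^esub>}" for l
  have K: "simplicial_ideal (decalage A) K"
    unfolding K_def ker_vertex_def by (rule simplicial_ideal_ker_vertex[OF Suc.prems(3)])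
  have N': "simplicial_ideal (decalage A) (\<lambda>l. N (Suc l))"
    by (rule simplicial_ideal_decalage[OF Suc.prems(4)])
  have T: "simplicial_ideal (decalage A) T"
    unfolding T_def by (rule simplicial_ideal_ker_face0[OF N'])
  have "pi0_trivial (decalage A) K"
    unfolding K_def ker_vertex_def by (rule pi0_trivial_ker_vertex[OF Suc.prems(3)])
  \<comment> \<open>The Moore differential of the decalage is \<open>d_1\<close> of
    \<open>A\<close>, whence \<open>face A (Suc n) 1\<close>.\<close>
  then obtain m1 where m1: "\<And>z. z \<in> moore_cycles (decalage A) n \<Longrightarrow>
      z \<in> ideal_power (level A (Suc n)) (K n) m1 \<cdot>\<^bsub>level A (Suc n)\<^esub> T n \<Longrightarrow>
      \<exists>u\<in>moore (decalage A) (Suc n). face A (Suc n) 1 u = z \<and>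
        u \<in> ideal_power (level A (Suc (Suc n))) (K (Suc n)) m \<cdot>\<^bsub>level A (Suc (Suc n))\<^esub> T (Suc n)"
    using Suc.IH[OF simplicial_cring_decalage _ K T, of m] Suc.prems(2)
    unfolding decalage_simps One_nat_def by blast
  \<comment> \<open>Artin--Rees is applied in the single degree that contains the boundary of the
    lift.\<close>
  obtain m2 where m2: "ideal_power (level A (Suc n)) (K n) m2 \<inter> T n \<subseteq>
      ideal_power (level A (Suc n)) (K n) m1 \<cdot>\<^bsub>level A (Suc n)\<^esub> T n"
    using artin_rees_weak[OF cring_level Suc.prems(2) simplicial_idealD(1)[OF K, simplified]
        simplicial_idealD(1)[OF T, simplified]] by blast
  \<comment> \<open>The bound \<open>m\<close> keeps the lift in \<open>I^m N\<close>; the bound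
    \<open>m2\<close> makes Artin--Rees available.\<close>
  define m' where "m' = max m m2"
  define P where "P l = ideal_power (level A (Suc l)) (K l) m' \<cdot>\<^bsub>level A (Suc l)\<^esub> N (Suc l)" for l
  \<comment> \<open>Corrections of a lift are taken from \<open>Q\<close>, so that its image under
    \<open>d_0\<close> does not change.\<close>
  define Q where "Q l = {x \<in> P l. face A l 0 x = \<zero>\<^bsub>level A l\<^esub>}" for l
  have P: "simplicial_ideal (decalage A) P"
    using D.simplicial_ideal_prod[OF D.simplicial_ideal_power[OF K] N']
    unfolding P_def decalage_simps .
  have Q: "simplicial_ideal (decalage A) Q"
    unfolding Q_def by (rule simplicial_ideal_ker_face0[OF P])
  have Pc: "x \<in> carrier (level A (Suc l))" if "x \<in> P l" for x l
    using simplicial_idealD(4)[OF P that] by simp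
  have QP: "x \<in> P l" "face A l 0 x = \<zero>\<^bsub>level A l\<^esub>" if "x \<in> Q l" for x l
    using that by (auto simp: Q_def)
  have PI: "P l \<subseteq> ideal_power (level A (Suc l)) (I (Suc l)) m \<cdot>\<^bsub>level A (Suc l)\<^esub> N (Suc l)" for l
    unfolding P_def K_def m'_def
    by (rule ker_vertex_product_subset[OF Suc.prems(3,4)]) simp
  have QT: "Q n \<subseteq> ideal_power (level A (Suc n)) (K n) m1 \<cdot>\<^bsub>level A (Suc n)\<^esub> T n"
  proof -
    have Kn: "ideal (K n) (level A (Suc n))" using simplicial_idealD(1)[OF K] by simp
    have "P n \<subseteq> ideal_power (level A (Suc n)) (K n) m' \<inter> N (Suc n)"
      unfolding P_def
      by (rule L.ideal_prod_inter[OF L.ideal_power_ideal[OF Kn] simplicial_idealD(1)[OF Suc.prems(4)]])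
    then have "Q n \<subseteq> ideal_power (level A (Suc n)) (K n) m' \<inter> T n" by (auto simp: Q_def T_def)
    also have "\<dots> \<subseteq> ideal_power (level A (Suc n)) (K n) m2 \<inter> T n"
      using L.ideal_power_antimono[OF Kn, of m2 m'] by (auto simp: m'_def)
    finally show ?thesis using m2 by blast
  qed
  show ?case
  proof (intro exI[of _ m'] ballI impI)
    fix z assume zc: "z \<in> moore_cycles A (Suc n)"
      and "z \<in> ideal_power (level A (Suc n)) (I (Suc n)) m' \<cdot>\<^bsub>level A (Suc n)\<^esub> N (Suc n)"
    from this(2) obtain y where y: "face A (Suc n) 0 y = z" "y \<in> P (Suc n)"
      unfolding P_def K_def by (rule product_lift[OF Suc.prems(3,4,5)])
    have zi: "face A n i z = \<zero>\<^bsub>level A n\<^esub>" if "i \<le> Suc n" for i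
      using zc that by (cases "i = 0") auto
    \<comment> \<open>All decalage faces of the lift die under \<open>d_0\<close>:
      \<open>d_0 d_(i+1) y = d_i d_0 y = d_i z\<close>, and every face of the cycle \<open>z\<close>
      vanishes.\<close>
    have yQ: "face A (Suc n) (Suc i) y \<in> Q n" if "i \<le> Suc n" for i
    proof -
      have "face A n 0 (face A (Suc n) (Suc i) y) = face A n i (face A (Suc n) 0 y)"
        using face_face[OF Pc[OF y(2)], of 0 "Suc i"] that by simp
      also have "\<dots> = \<zero>\<^bsub>level A n\<^esub>" using zi[OF that] y(1) by simp
      finally show ?thesis
        using simplicial_idealD(2)[OF P that y(2)] by (simp add: Q_def)
    qed
    \<comment> \<open>The lift becomes a Moore chain of the decalage and still maps to
      \<open>z\<close>.\<close>
    obtain q where q: "q \<in> Q (Suc n)" "y \<ominus>\<^bsub>level A (Suc (Suc n))\<^esub> q \<in> moore (decalage A) (Suc n)"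
      using D.moore_correction[of Q y n] Q yQ Pc[OF y(2)] ideal.axioms(1)
      unfolding simplicial_ideal_def decalage_simps by blast
    define y1 where "y1 = y \<ominus>\<^bsub>level A (Suc (Suc n))\<^esub> q"
    have cs: "y \<in> carrier (level A (Suc (Suc n)))" "q \<in> carrier (level A (Suc (Suc n)))"
      using Pc y(2) QP(1)[OF q(1)] by blast+
    have y1c: "y1 \<in> carrier (level A (Suc (Suc n)))" using cs by (simp add: y1_def)
    have y1m: "y1 \<in> moore (decalage A) (Suc n)" using q(2) by (simp only: y1_def)
    have "face A (Suc n) 1 y1 = face A (Suc n) 1 y \<ominus>\<^bsub>level A (Suc n)\<^esub> face A (Suc n) 1 q"
      unfolding y1_def using cs by (intro face_minus) simp_all
    also have "\<dots> \<in> Q n"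
      using yQ[of 0] simplicial_idealD(2)[OF Q _ q(1), of 0] simplicial_idealD(1)[OF Q, of n]
      by (intro L.ideal_minus_closed) simp_all
    finally have "face A (Suc n) 1 y1 \<in> ideal_power (level A (Suc n)) (K n) m1 \<cdot>\<^bsub>level A (Suc n)\<^esub> T n"
      using QT by blast
    moreover have "face A (Suc n) 1 y1 \<in> moore_cycles (decalage A) n"
      using D.moore_face_cycle[OF y1m] by simp
    \<comment> \<open>The boundary of \<open>y1\<close> bounds inside \<open>K^m T\<close>, so
      \<open>w\<close> removes that boundary without being seen by \<open>d_0\<close>.\<close>
    ultimately obtain w where w: "w \<in> moore (decalage A) (Suc n)" "face A (Suc n) 1 w = face A (Suc n) 1 y1"
      "w \<in> ideal_power (level A (Suc (Suc n))) (K (Suc n)) m \<cdot>\<^bsub>level A (Suc (Suc n))\<^esub> T (Suc n)"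
      using m1 by blast
    have wN: "w \<in> ideal_power (level A (Suc (Suc n))) (K (Suc n)) m \<cdot>\<^bsub>level A (Suc (Suc n))\<^esub> N (Suc (Suc n))"
      using w(3) ideal_prod_mono[OF order_refl, of "T (Suc n)" "N (Suc (Suc n))"] unfolding T_def by blast
    then have wI: "w \<in> ideal_power (level A (Suc (Suc n))) (I (Suc (Suc n))) m
        \<cdot>\<^bsub>level A (Suc (Suc n))\<^esub> N (Suc (Suc n))"
      using ker_vertex_product_subset[OF Suc.prems(3,4) order_refl] unfolding K_def by blast
    have "w \<in> T (Suc n)"
      using w(3) L.ideal_prod_inter[OF L.ideal_power_ideal[OF simplicial_idealD(1)[OF K, simplified]]
          simplicial_idealD(1)[OF T, simplified]] by blast
    then have w0: "face A (Suc n) 0 w = \<zero>\<^bsub>level A (Suc n)\<^esub>" by (simp add: T_def)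
    have wc: "w \<in> carrier (level A (Suc (Suc n)))" using D.moore_carrier[OF w(1)] by simp
    \<comment> \<open>Here \<open>d_0 u = z\<close> because \<open>d_0 w\<close> vanishes,
      \<open>d_1 u = 0\<close> because \<open>w\<close> and \<open>y1\<close> have the same decalage
      boundary, and the higher faces vanish since both are Moore chains of the decalage.\<close>
    define u where "u = y1 \<ominus>\<^bsub>level A (Suc (Suc n))\<^esub> w"
    have uc: "u \<in> carrier (level A (Suc (Suc n)))" using y1c wc by (simp add: u_def)
    have fu: "face A (Suc n) i u = face A (Suc n) i y1 \<ominus>\<^bsub>level A (Suc n)\<^esub> face A (Suc n) i w"
      if "i \<le> Suc (Suc n)" for i
      unfolding u_def using that y1c wc by (intro face_minus)
    have zcar: "z \<in> carrier (level A (Suc n))" using zc by simp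
    have "face A (Suc n) 0 y1 = z \<ominus>\<^bsub>level A (Suc n)\<^esub> \<zero>\<^bsub>level A (Suc n)\<^esub>"
      unfolding y1_def using cs y(1) QP(2)[OF q(1)] by (subst face_minus) simp_all
    then have "face A (Suc n) 0 u = z" using fu[of 0] w0 zcar by (simp add: a_minus_def)
    moreover have "u \<in> moore A (Suc (Suc n))"
    proof -
      have "face A (Suc n) i u = \<zero>\<^bsub>level A (Suc n)\<^esub>" if i: "1 \<le> i" "i \<le> Suc (Suc n)" for i
      proof (cases "i = 1")
        case True
        then show ?thesis using fu[of 1] w(2) y1c by simp
      next
        case False
        then have "face A (Suc n) i y1 = \<zero>\<^bsub>level A (Suc n)\<^esub>" "face A (Suc n) i w = \<zero>\<^bsub>level A (Suc n)\<^esub>"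
          using D.moore_SucD(2)[OF y1m, of "i - 1"] D.moore_SucD(2)[OF w(1), of "i - 1"] i by simp_all
        then show ?thesis using fu[OF i(2)] by simp
      qed
      then show ?thesis using uc by simp
    qed
    moreover have "u \<in> ideal_power (level A (Suc (Suc n))) (I (Suc (Suc n))) m
        \<cdot>\<^bsub>level A (Suc (Suc n))\<^esub> N (Suc (Suc n))"
    proof -
      have id: "ideal (ideal_power (level A (Suc (Suc n))) (I (Suc (Suc n))) m
          \<cdot>\<^bsub>level A (Suc (Suc n))\<^esub> N (Suc (Suc n))) (level A (Suc (Suc n)))"
        by (intro L.ideal_prod_is_ideal L.ideal_power_ideal simplicial_idealD(1) Suc.prems(3,4))
      show ?thesis unfolding u_def y1_def
        using y(2) QP(1)[OF q(1)] PI[of "Suc n"] by (intro L.ideal_minus_closed[OF id] wI) blast+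
    qed
    ultimately show "\<exists>u\<in>moore A (Suc (Suc n)). face A (Suc n) 0 u = z \<and>
        u \<in> ideal_power (level A (Suc (Suc n))) (I (Suc (Suc n))) m
          \<cdot>\<^bsub>level A (Suc (Suc n))\<^esub> N (Suc (Suc n))" by blast
  qed
qed

section \<open>The augmentation ideal\<close>

context simplicial_cring
begin

interpretation L: cring "level A l" for l
  by (rule cring_level)

lemma face_a_inv:
  assumes "i \<le> Suc n" "x \<in> carrier (level A (Suc n))"
  shows "face A n i (\<ominus>\<^bsub>level A (Suc n)\<^esub> x) = \<ominus>\<^bsub>level A n\<^esub> face A n i x"
proof -
  interpret ring_hom_ring "level A (Suc n)" "level A n" "face A n i"
    by (rule face_ring_hom_ring[OF assms(1)])
  show ?thesis using assms by simp
qed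

lemma moore_add_subgroup: "additive_subgroup (moore A n) (level A n)"
proof (rule L.additive_subgroup_byI)
  show "moore A n \<subseteq> carrier (level A n)" using moore_carrier by blast
  show "\<zero>\<^bsub>level A n\<^esub> \<in> moore A n" by (cases n) auto
  show "\<ominus>\<^bsub>level A n\<^esub> a \<in> moore A n" "a \<oplus>\<^bsub>level A n\<^esub> b \<in> moore A n"
    if "a \<in> moore A n" "b \<in> moore A n" for a b
    using that by (cases n; auto simp: face_add face_a_inv)+
qed

lemma moore_minus: "a \<in> moore A n \<Longrightarrow> b \<in> moore A n \<Longrightarrow> a \<ominus>\<^bsub>level A n\<^esub> b \<in> moore A n"
  using additive_subgroup.a_closed[OF moore_add_subgroup] L.abelian_group_axioms
    additive_subgroup.a_inv_closed[OF moore_add_subgroup] by (simp add: a_minus_def)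

lemma moore_cycles_add_subgroup: "additive_subgroup (moore_cycles A n) (level A n)"
proof (rule L.additive_subgroup_byI)
  show "moore_cycles A n \<subseteq> carrier (level A n)" using moore_carrier moore_cycles_moore by blast
  show "\<zero>\<^bsub>level A n\<^esub> \<in> moore_cycles A n" by (cases n) auto
  show "\<ominus>\<^bsub>level A n\<^esub> a \<in> moore_cycles A n" "a \<oplus>\<^bsub>level A n\<^esub> b \<in> moore_cycles A n"
    if "a \<in> moore_cycles A n" "b \<in> moore_cycles A n" for a b
    using that by (cases n; auto simp: face_add face_a_inv)+
qed

lemma moore_boundaries_add_subgroup: "additive_subgroup (moore_boundaries A n) (level A n)"
proof -
  interpret h: ring_hom_ring "level A (Suc n)" "level A n" "face A n 0" by (rule face_ring_hom_ring) simp
  have "subgroup (face A n 0 ` moore A (Suc n)) (add_monoid (level A n))"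
    by (rule group_hom.subgroup_img_is_subgroup[OF h.a_group_hom])
      (rule additive_subgroup.a_subgroup[OF moore_add_subgroup])
  then show ?thesis unfolding moore_boundaries_def by (rule additive_subgroupI)
qed

lemma moore_boundaries_subset_cycles: "moore_boundaries A n \<subseteq> moore_cycles A n"
  unfolding moore_boundaries_def using moore_face_cycle by blast

text \<open>For a Moore chain \<open>w\<close> of degree 1, \<open>x d_0 w = d_0 (s_0 x w)\<close>,
  and \<open>s_0 x w\<close> is again killed by \<open>d_1\<close>.\<close>

lemma moore_boundaries_ideal: "ideal (moore_boundaries A 0) (level A 0)"
proof (rule idealI[OF L.ring_axioms])
  show "subgroup (moore_boundaries A 0) (add_monoid (level A 0))"
    by (rule additive_subgroup.a_subgroup[OF moore_boundaries_add_subgroup])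
  fix a x assume "a \<in> moore_boundaries A 0" and x: "x \<in> carrier (level A 0)"
  then obtain w where w: "w \<in> moore A (Suc 0)" "a = face A 0 0 w" by (auto simp: moore_boundaries_def)
  note wc = moore_SucD[OF w(1)]
  have s: "degen A 0 0 x \<in> carrier (level A (Suc 0))"
    "face A 0 0 (degen A 0 0 x) = x" "face A 0 (Suc 0) (degen A 0 0 x) = x"
    using x face_degen_same[OF x, of 0] by auto
  have mult: "face A 0 i (u \<otimes>\<^bsub>level A (Suc 0)\<^esub> v) = face A 0 i u \<otimes>\<^bsub>level A 0\<^esub> face A 0 i v"
    if "i \<le> Suc 0" "u \<in> carrier (level A (Suc 0))" "v \<in> carrier (level A (Suc 0))" for i u v
    using ring_hom_mult[OF face_hom[OF that(1)] that(2,3)] .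
  have "degen A 0 0 x \<otimes>\<^bsub>level A (Suc 0)\<^esub> w \<in> moore A (Suc 0)"
    using s wc(1) wc(2)[of 1] x by (simp add: mult)
  moreover have xa: "face A 0 0 (degen A 0 0 x \<otimes>\<^bsub>level A (Suc 0)\<^esub> w) = x \<otimes>\<^bsub>level A 0\<^esub> a"
    using s wc(1) w(2) by (simp add: mult)
  ultimately show "x \<otimes>\<^bsub>level A 0\<^esub> a \<in> moore_boundaries A 0" unfolding moore_boundaries_def by force
  then show "a \<otimes>\<^bsub>level A 0\<^esub> x \<in> moore_boundaries A 0"
    using L.m_comm[OF x, of a] wc(1) w(2) by simp
qed

lemma mem_aug_ideal_iff:
  "x \<in> aug_ideal A n \<longleftrightarrow> x \<in> carrier (level A n) \<and> vertex A n x \<in> moore_boundaries A 0"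
proof -
  interpret B: ideal "moore_boundaries A 0" "level A 0" by (rule moore_boundaries_ideal)
  have "moore_boundaries A 0 +>\<^bsub>level A 0\<^esub> v = moore_boundaries A 0 \<longleftrightarrow> v \<in> moore_boundaries A 0"
    if "v \<in> carrier (level A 0)" for v
    using that B.a_rcos_const B.rcos_const_imp_mem by blast
  then show ?thesis
    using ring_hom_closed[OF vertex_hom, of x n]
    unfolding aug_ideal_def a_kernel_def' augmentation_def pi0_ring_def FactRing_def by auto
qed

lemma aug_ideal_ideal: "ideal (aug_ideal A n) (level A n)"
proof -
  interpret h: ring_hom_ring "level A n" "level A 0" "vertex A n"
    by (intro ring_hom_ringI2 vertex_hom L.ring_axioms)
  have "aug_ideal A n = {r \<in> carrier (level A n). vertex A n r \<in> moore_boundaries A 0}"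
    using mem_aug_ideal_iff by blast
  then show ?thesis using h.ideal_vimage[OF moore_boundaries_ideal] by simp
qed

text \<open>Two vertices joined by an edge agree in \<open>\<pi>\<^sub>0(A)\<close>: in degree 1 the
  difference \<open>d_0 x - d_1 x\<close> is the boundary of \<open>x - s_0 d_1 x\<close>. Higher
  degrees reduce to this by applying top faces.\<close>

lemma vertex_face_0:
  assumes "x \<in> carrier (level A (Suc n))"
  shows "vertex A n (face A n 0 x) \<ominus>\<^bsub>level A 0\<^esub> vertex A (Suc n) x \<in> moore_boundaries A 0"
  using assms
proof (induction n arbitrary: x)
  case 0
  define y where "y = x \<ominus>\<^bsub>level A (Suc 0)\<^esub> degen A 0 0 (face A 0 1 x)"
  have d: "face A 0 1 x \<in> carrier (level A 0)" "degen A 0 0 (face A 0 1 x) \<in> carrier (level A (Suc 0))"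
    using 0 by simp_all
  have "face A 0 (Suc 0) y = \<zero>\<^bsub>level A 0\<^esub>" "face A 0 0 y = face A 0 0 x \<ominus>\<^bsub>level A 0\<^esub> face A 0 1 x"
    unfolding y_def using 0 d face_degen_same[OF d(1), of 0] by (simp_all add: face_minus)
  moreover have "y \<in> carrier (level A (Suc 0))" using 0 d by (simp add: y_def)
  ultimately show ?case unfolding moore_boundaries_def by (intro image_eqI[of _ _ y]) auto
next
  case (Suc n)
  have "face A n (Suc n) (face A (Suc n) 0 x) = face A n 0 (face A (Suc n) (Suc (Suc n)) x)"
    using face_face[OF Suc.prems, of 0 "Suc (Suc n)"] by simp
  then show ?case using Suc.IH[of "face A (Suc n) (Suc (Suc n)) x"] Suc.prems by simp
qed

text \<open>Degeneracies and faces of positive index fix the initial vertex, and \<open>d_0\<close>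
  changes it only by a boundary.\<close>

lemma aug_ideal_simplicial: "simplicial_ideal A (aug_ideal A)"
  unfolding simplicial_ideal_def simplicial_stable_def
proof (intro conjI allI impI image_subsetI)
  show "ideal (aug_ideal A n) (level A n)" for n by (rule aug_ideal_ideal)
next
  interpret B: ideal "moore_boundaries A 0" "level A 0" by (rule moore_boundaries_ideal)
  fix n i x assume i: "i \<le> Suc n" and "x \<in> aug_ideal A (Suc n)"
  then have x: "x \<in> carrier (level A (Suc n))" "vertex A (Suc n) x \<in> moore_boundaries A 0"
    by (simp_all only: mem_aug_ideal_iff)
  have "vertex A n (face A n i x) \<in> moore_boundaries A 0"
  proof (cases "i = 0")
    case True
    define a b where "a = vertex A n (face A n 0 x)" and "b = vertex A (Suc n) x"
    have ab: "a \<in> carrier (level A 0)" "b \<in> carrier (level A 0)"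
      unfolding a_def b_def using x i by (auto intro!: ring_hom_closed[OF vertex_hom] simp del: vertex.simps)
    have "(a \<ominus>\<^bsub>level A 0\<^esub> b) \<oplus>\<^bsub>level A 0\<^esub> b \<in> moore_boundaries A 0"
      unfolding a_def b_def by (intro B.a_closed vertex_face_0 x)
    also have "(a \<ominus>\<^bsub>level A 0\<^esub> b) \<oplus>\<^bsub>level A 0\<^esub> b = a" using ab by algebra
    finally show ?thesis by (simp add: True a_def)
  next
    case False
    then show ?thesis using vertex_face[OF x(1), of i] x(2) i by simp
  qed
  then show "face A n i x \<in> aug_ideal A n" using x i by (simp add: mem_aug_ideal_iff)
next
  fix n i x assume "i \<le> n" "x \<in> aug_ideal A n"
  then show "degen A n i x \<in> aug_ideal A (Suc n)"
    by (simp add: mem_aug_ideal_iff vertex_degen del: vertex.simps)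
qed

text \<open>In degree 0 the augmentation ideal consists of the boundaries. A bounding Moore chain
  has initial vertex \<open>d_1 w = 0\<close>, so it lies in the augmentation ideal itself.\<close>

lemma aug_ideal_pi0_trivial: "pi0_trivial A (aug_ideal A)"
  unfolding pi0_trivial_def
proof
  fix v assume "v \<in> aug_ideal A 0"
  then obtain w where w: "w \<in> moore A (Suc 0)" "v = face A 0 0 w"
    by (auto simp: mem_aug_ideal_iff moore_boundaries_def)
  have "\<zero>\<^bsub>level A 0\<^esub> \<in> moore_boundaries A 0"
    by (rule additive_subgroup.zero_closed[OF moore_boundaries_add_subgroup])
  then have "w \<in> aug_ideal A 1" using w(1) by (simp add: mem_aug_ideal_iff)
  then show "\<exists>w\<in>aug_ideal A 1. face A 0 1 w = \<zero>\<^bsub>level A 0\<^esub> \<and> face A 0 0 w = v"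
    using w by auto
qed

end

section \<open>Adic completion\<close>

locale cring_with_ideal = cring R for R (structure) +
  fixes I
  assumes ideal_I: "ideal I R"
begin

lemma power_ideal: "ideal (ideal_power R I m) R"
  by (rule ideal_power_ideal[OF ideal_I])

lemma power_subgroup: "additive_subgroup (ideal_power R I m) R"
  by (rule ideal.axioms(1)[OF power_ideal])

lemma coset_closed: "x \<in> carrier R \<Longrightarrow> ideal_power R I m +> x \<in> carrier (R Quot ideal_power R I m)"
  using ring_hom_closed[OF ideal.rcos_ring_hom[OF power_ideal]] .

lemma coset_eq_iff:
  assumes "x \<in> carrier R" "y \<in> carrier R"
  shows "ideal_power R I m +> x = ideal_power R I m +> y \<longleftrightarrow> x \<ominus> y \<in> ideal_power R I m"
  using quotient_eq_iff_same_a_r_cos[OF power_ideal assms] by blast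

text \<open>Working with a chosen representative of each coset turns identities in the completion
  into termwise identities in \<open>R\<close>.\<close>

definition residues_of :: "(nat \<Rightarrow> 'a) \<Rightarrow> nat \<Rightarrow> 'a set"
  where "residues_of x = (\<lambda>m. ideal_power R I m +> x m)"

text \<open>A Cauchy condition with prescribed rate, matching exactly the compatibility of residues
  under the transition maps.\<close>

definition adic_cauchy :: "(nat \<Rightarrow> 'a) \<Rightarrow> bool"
  where "adic_cauchy x \<longleftrightarrow> (\<forall>m. x m \<in> carrier R \<and> x (Suc m) \<ominus> x m \<in> ideal_power R I m)"

lemma minus_self: "x \<in> carrier R \<Longrightarrow> x \<ominus> x = \<zero>"
  by (simp add: minus_eq r_neg)

lemma residues_of_eq_iff:
  assumes "\<And>m. x m \<in> carrier R" "\<And>m. y m \<in> carrier R"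
  shows "residues_of x = residues_of y \<longleftrightarrow> (\<forall>m. x m \<ominus> y m \<in> ideal_power R I m)"
  by (simp add: residues_of_def fun_eq_iff coset_eq_iff assms)

lemma transition_coset:
  assumes "x \<in> carrier R"
  shows "ideal_power R I m <+>\<^bsub>R\<^esub> (ideal_power R I (Suc m) +> x) = ideal_power R I m +> x"
  using add_coset_image[OF abelian_group_axioms abelian_group_axioms power_subgroup power_subgroup,
      of "\<lambda>x. x" "Suc m" m x] ideal_power_Suc_subset[OF ideal_I] assms by simp

lemma residues_of_mem_iff:
  assumes "\<And>m. x m \<in> carrier R"
  shows "residues_of x \<in> carrier (adic_completion R I) \<longleftrightarrow> adic_cauchy x"
  by (simp add: adic_completion_def residues_of_def adic_cauchy_def coset_closed assms
      transition_coset coset_eq_iff)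

lemma adic_completionE:
  assumes "s \<in> carrier (adic_completion R I)"
  obtains x where "adic_cauchy x" "s = residues_of x"
proof -
  have "\<forall>m. \<exists>x\<in>carrier R. s m = ideal_power R I m +> x"
    using assms by (auto simp: adic_completion_def FactRing_def A_RCOSETS_def')
  then obtain x where x: "\<And>m. x m \<in> carrier R" "s = residues_of x"
    unfolding residues_of_def fun_eq_iff by metis
  then show ?thesis using that residues_of_mem_iff assms by blast
qed

lemma adic_cauchyD: "adic_cauchy x \<Longrightarrow> x m \<in> carrier R"
  by (simp add: adic_cauchy_def)

lemma adic_cauchy_diff:
  assumes x: "adic_cauchy x" and "m \<le> k"
  shows "x k \<ominus> x m \<in> ideal_power R I m"
  using assms(2)
proof (induction rule: dec_induct)
  case base
  then show ?case
    using additive_subgroup.zero_closed[OF power_subgroup] by (simp add: minus_self adic_cauchyD[OF x])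
next
  case (step k)
  have "x (Suc k) \<ominus> x k \<in> ideal_power R I m"
    using x ideal_power_antimono[OF ideal_I step.hyps(1)] by (auto simp: adic_cauchy_def)
  then have "(x (Suc k) \<ominus> x k) \<oplus> (x k \<ominus> x m) \<in> ideal_power R I m"
    by (rule additive_subgroup.a_closed[OF power_subgroup _ step.IH])
  also have "(x (Suc k) \<ominus> x k) \<oplus> (x k \<ominus> x m) = x (Suc k) \<ominus> x m"
    using adic_cauchyD[OF x, of "Suc k"] adic_cauchyD[OF x, of k] adic_cauchyD[OF x, of m] by algebra
  finally show ?case .
qed

lemma residues_of_mult:
  assumes "\<And>m. x m \<in> carrier R" "\<And>m. y m \<in> carrier R"
  shows "residues_of x \<otimes>\<^bsub>adic_completion R I\<^esub> residues_of y = residues_of (\<lambda>m. x m \<otimes> y m)"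
  using ring_hom_mult[OF ideal.rcos_ring_hom[OF power_ideal] assms]
  by (simp add: adic_completion_def residues_of_def fun_eq_iff)

lemma residues_of_add:
  assumes "\<And>m. x m \<in> carrier R" "\<And>m. y m \<in> carrier R"
  shows "residues_of x \<oplus>\<^bsub>adic_completion R I\<^esub> residues_of y = residues_of (\<lambda>m. x m \<oplus> y m)"
  using ring_hom_add[OF ideal.rcos_ring_hom[OF power_ideal] assms]
  by (simp add: adic_completion_def residues_of_def fun_eq_iff)

lemma adic_completion_one: "\<one>\<^bsub>adic_completion R I\<^esub> = residues_of (\<lambda>m. \<one>)"
  by (simp add: adic_completion_def residues_of_def FactRing_def)

lemma adic_completion_zero: "\<zero>\<^bsub>adic_completion R I\<^esub> = residues_of (\<lambda>m. \<zero>)"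
  using abelian_subgroup.a_rcos_const[OF abelian_subgroupI3[OF power_subgroup abelian_group_axioms]
      additive_subgroup.zero_closed[OF power_subgroup]]
  by (simp add: adic_completion_def residues_of_def FactRing_def)

lemma adic_cauchy_const: "x \<in> carrier R \<Longrightarrow> adic_cauchy (\<lambda>m. x)"
  using additive_subgroup.zero_closed[OF power_subgroup]
  by (simp add: adic_cauchy_def minus_self)

lemma adic_cauchy_add:
  assumes "adic_cauchy x" "adic_cauchy y"
  shows "adic_cauchy (\<lambda>m. x m \<oplus> y m)"
  unfolding adic_cauchy_def
proof (intro allI conjI)
  fix m
  note c = assms[THEN adic_cauchyD]
  show "x m \<oplus> y m \<in> carrier R" using c by simp
  have "(x (Suc m) \<ominus> x m) \<oplus> (y (Suc m) \<ominus> y m) \<in> ideal_power R I m"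
    using assms by (intro additive_subgroup.a_closed[OF power_subgroup]) (simp_all add: adic_cauchy_def)
  also have "(x (Suc m) \<ominus> x m) \<oplus> (y (Suc m) \<ominus> y m) = (x (Suc m) \<oplus> y (Suc m)) \<ominus> (x m \<oplus> y m)"
    using c(1)[of m] c(1)[of "Suc m"] c(2)[of m] c(2)[of "Suc m"] by algebra
  finally show "(x (Suc m) \<oplus> y (Suc m)) \<ominus> (x m \<oplus> y m) \<in> ideal_power R I m" .
qed

lemma adic_cauchy_mult:
  assumes "adic_cauchy x" "adic_cauchy y"
  shows "adic_cauchy (\<lambda>m. x m \<otimes> y m)"
  unfolding adic_cauchy_def
proof (intro allI conjI)
  fix m
  interpret J: ideal "ideal_power R I m" R by (rule power_ideal)
  note c = assms[THEN adic_cauchyD]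
  show "x m \<otimes> y m \<in> carrier R" using c by simp
  \<comment> \<open>The usual splitting of a difference of products, in which each term has a factor
    in \<open>I^m\<close>.\<close>
  have "(x (Suc m) \<ominus> x m) \<otimes> y (Suc m) \<oplus> x m \<otimes> (y (Suc m) \<ominus> y m) \<in> ideal_power R I m"
    using assms c by (intro J.a_closed J.I_l_closed J.I_r_closed) (simp_all add: adic_cauchy_def)
  also have "(x (Suc m) \<ominus> x m) \<otimes> y (Suc m) \<oplus> x m \<otimes> (y (Suc m) \<ominus> y m)
      = (x (Suc m) \<otimes> y (Suc m)) \<ominus> (x m \<otimes> y m)"
    using c(1)[of m] c(1)[of "Suc m"] c(2)[of m] c(2)[of "Suc m"] by algebra
  finally show "(x (Suc m) \<otimes> y (Suc m)) \<ominus> (x m \<otimes> y m) \<in> ideal_power R I m" .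
qed

lemma adic_cauchy_a_inv:
  assumes "adic_cauchy x"
  shows "adic_cauchy (\<lambda>m. \<ominus> x m)"
  using adic_cauchy_mult[OF adic_cauchy_const[of "\<ominus> \<one>"] assms] adic_cauchyD[OF assms]
  by (simp add: l_minus)

lemma residues_of_closed: "adic_cauchy x \<Longrightarrow> residues_of x \<in> carrier (adic_completion R I)"
  using residues_of_mem_iff adic_cauchyD by blast

text \<open>Each axiom is checked on representatives, where it is the same axiom of \<open>R\<close>
  applied termwise.\<close>

lemma adic_completion_cring: "cring (adic_completion R I)"
proof (rule cringI)
  have mult: "residues_of x \<otimes>\<^bsub>adic_completion R I\<^esub> residues_of y = residues_of (\<lambda>m. x m \<otimes> y m)"
    and add: "residues_of x \<oplus>\<^bsub>adic_completion R I\<^esub> residues_of y = residues_of (\<lambda>m. x m \<oplus> y m)"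
    if "adic_cauchy x" "adic_cauchy y" for x y
    using that[THEN adic_cauchyD] by (rule residues_of_mult residues_of_add)+
  note simps = mult add residues_of_closed adic_cauchy_add adic_cauchy_mult adic_cauchy_const
    adic_completion_one adic_completion_zero
  show "abelian_group (adic_completion R I)"
  proof (rule abelian_groupI)
    fix s assume "s \<in> carrier (adic_completion R I)"
    then obtain x where x: "adic_cauchy x" "s = residues_of x" by (rule adic_completionE)
    note xc = adic_cauchyD[OF x(1)]
    show "\<exists>t\<in>carrier (adic_completion R I).
        t \<oplus>\<^bsub>adic_completion R I\<^esub> s = \<zero>\<^bsub>adic_completion R I\<^esub>"
      using x by (intro bexI[of _ "residues_of (\<lambda>m. \<ominus> x m)"]) (simp_all add: simps adic_cauchy_a_inv l_neg xc)
    show "\<zero>\<^bsub>adic_completion R I\<^esub> \<oplus>\<^bsub>adic_completion R I\<^esub> s = s"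
      using x by (simp add: simps xc)
    fix t assume "t \<in> carrier (adic_completion R I)"
    then obtain y where y: "adic_cauchy y" "t = residues_of y" by (rule adic_completionE)
    note yc = adic_cauchyD[OF y(1)]
    show "s \<oplus>\<^bsub>adic_completion R I\<^esub> t \<in> carrier (adic_completion R I)"
      using x y by (simp add: simps)
    show "s \<oplus>\<^bsub>adic_completion R I\<^esub> t = t \<oplus>\<^bsub>adic_completion R I\<^esub> s"
      using x y by (simp add: simps a_comm xc yc)
    fix u assume "u \<in> carrier (adic_completion R I)"
    then obtain z where z: "adic_cauchy z" "u = residues_of z" by (rule adic_completionE)
    show "s \<oplus>\<^bsub>adic_completion R I\<^esub> t \<oplus>\<^bsub>adic_completion R I\<^esub> u
        = s \<oplus>\<^bsub>adic_completion R I\<^esub> (t \<oplus>\<^bsub>adic_completion R I\<^esub> u)"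
      using x y z by (simp add: simps a_assoc xc yc adic_cauchyD[OF z(1)])
  qed (simp add: simps)
  show "comm_monoid (adic_completion R I)"
  proof (rule comm_monoidI)
    fix s assume "s \<in> carrier (adic_completion R I)"
    then obtain x where x: "adic_cauchy x" "s = residues_of x" by (rule adic_completionE)
    note xc = adic_cauchyD[OF x(1)]
    show "\<one>\<^bsub>adic_completion R I\<^esub> \<otimes>\<^bsub>adic_completion R I\<^esub> s = s"
      using x by (simp add: simps xc)
    fix t assume "t \<in> carrier (adic_completion R I)"
    then obtain y where y: "adic_cauchy y" "t = residues_of y" by (rule adic_completionE)
    note yc = adic_cauchyD[OF y(1)]
    show "s \<otimes>\<^bsub>adic_completion R I\<^esub> t \<in> carrier (adic_completion R I)"
      using x y by (simp add: simps)
    show "s \<otimes>\<^bsub>adic_completion R I\<^esub> t = t \<otimes>\<^bsub>adic_completion R I\<^esub> s"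
      using x y by (simp add: simps m_comm xc yc)
    fix u assume "u \<in> carrier (adic_completion R I)"
    then obtain z where z: "adic_cauchy z" "u = residues_of z" by (rule adic_completionE)
    show "s \<otimes>\<^bsub>adic_completion R I\<^esub> t \<otimes>\<^bsub>adic_completion R I\<^esub> u
        = s \<otimes>\<^bsub>adic_completion R I\<^esub> (t \<otimes>\<^bsub>adic_completion R I\<^esub> u)"
      using x y z by (simp add: simps m_assoc xc yc adic_cauchyD[OF z(1)])
  qed (simp add: simps)
  fix s t u
  assume "s \<in> carrier (adic_completion R I)" "t \<in> carrier (adic_completion R I)"
    "u \<in> carrier (adic_completion R I)"
  then obtain x y z where "adic_cauchy x" "s = residues_of x" "adic_cauchy y" "t = residues_of y"
    "adic_cauchy z" "u = residues_of z"
    by (elim adic_completionE)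
  then show "(s \<oplus>\<^bsub>adic_completion R I\<^esub> t) \<otimes>\<^bsub>adic_completion R I\<^esub> u
      = s \<otimes>\<^bsub>adic_completion R I\<^esub> u \<oplus>\<^bsub>adic_completion R I\<^esub> t \<otimes>\<^bsub>adic_completion R I\<^esub> u"
    by (simp add: simps l_distr adic_cauchyD[of x] adic_cauchyD[of y] adic_cauchyD[of z])
qed

lemma completion_unit_eq: "completion_unit R I x = residues_of (\<lambda>m. x)"
  by (simp add: completion_unit_def residues_of_def)

lemma completion_unit_hom: "completion_unit R I \<in> ring_hom R (adic_completion R I)"
  by (rule ring_hom_memI)
    (simp_all add: completion_unit_eq residues_of_closed adic_cauchy_const residues_of_mult
      residues_of_add adic_completion_one)

end

lemma completion_map_residues:
  assumes "cring_with_ideal R I" "cring_with_ideal S J" "h \<in> ring_hom R S" "h ` I \<subseteq> J"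
    and "\<And>m. x m \<in> carrier R"
  shows "completion_map S J h (cring_with_ideal.residues_of R I x)
    = cring_with_ideal.residues_of S J (\<lambda>m. h (x m))"
proof -
  interpret R: cring_with_ideal R I by fact
  interpret S: cring_with_ideal S J by fact
  have "ideal_power S J m <+>\<^bsub>S\<^esub> h ` (ideal_power R I m +>\<^bsub>R\<^esub> x m) = ideal_power S J m +>\<^bsub>S\<^esub> h (x m)" for m
    by (rule add_coset_image[OF R.abelian_group_axioms S.abelian_group_axioms R.power_subgroup
          S.power_subgroup _ _ ideal_power_image_subset[OF assms(3) R.ideal_I assms(4)] assms(5)])
      (rule ring_hom_closed[OF assms(3)] ring_hom_add[OF assms(3)]; assumption)+
  then show ?thesis by (simp add: completion_map_def R.residues_of_def S.residues_of_def)
qed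

lemma adic_cauchy_hom:
  assumes "cring_with_ideal R I" "cring_with_ideal S J" "h \<in> ring_hom R S" "h ` I \<subseteq> J"
    and "cring_with_ideal.adic_cauchy R I x"
  shows "cring_with_ideal.adic_cauchy S J (\<lambda>m. h (x m))"
proof -
  interpret R: cring_with_ideal R I by fact
  interpret S: cring_with_ideal S J by fact
  interpret h: ring_hom_ring R S h by (intro ring_hom_ringI2 R.ring_axioms S.ring_axioms assms(3))
  have x: "x m \<in> carrier R" for m by (rule R.adic_cauchyD[OF assms(5)])
  have "h (x (Suc m) \<ominus>\<^bsub>R\<^esub> x m) \<in> ideal_power S J m" for m
  proof -
    have "x (Suc m) \<ominus>\<^bsub>R\<^esub> x m \<in> ideal_power R I m"
      using assms(5) unfolding R.adic_cauchy_def by blast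
    then show ?thesis using ideal_power_image_subset[OF assms(3) R.ideal_I assms(4)] by blast
  qed
  moreover have "h (x (Suc m) \<ominus>\<^bsub>R\<^esub> x m) = h (x (Suc m)) \<ominus>\<^bsub>S\<^esub> h (x m)" for m
    using x by (simp add: a_minus_def)
  ultimately show ?thesis using x by (simp add: S.adic_cauchy_def)
qed

lemma completion_map_hom:
  assumes "cring_with_ideal R I" "cring_with_ideal S J" "h \<in> ring_hom R S" "h ` I \<subseteq> J"
  shows "completion_map S J h \<in> ring_hom (adic_completion R I) (adic_completion S J)"
proof -
  interpret R: cring_with_ideal R I by fact
  interpret S: cring_with_ideal S J by fact
  note rep = completion_map_residues[OF assms]
  note hc = ring_hom_closed[OF assms(3)] and hm = ring_hom_mult[OF assms(3)]
    and ha = ring_hom_add[OF assms(3)]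
  show ?thesis
  proof (rule ring_hom_memI)
    fix s assume "s \<in> carrier (adic_completion R I)"
    then obtain x where x: "R.adic_cauchy x" "s = R.residues_of x" by (rule R.adic_completionE)
    note xc = R.adic_cauchyD[OF x(1)]
    show "completion_map S J h s \<in> carrier (adic_completion S J)"
      unfolding x(2) rep[OF xc] by (intro S.residues_of_closed adic_cauchy_hom[OF assms x(1)])
    fix t assume "t \<in> carrier (adic_completion R I)"
    then obtain y where y: "R.adic_cauchy y" "t = R.residues_of y" by (rule R.adic_completionE)
    note yc = R.adic_cauchyD[OF y(1)]
    show "completion_map S J h (s \<otimes>\<^bsub>adic_completion R I\<^esub> t)
        = completion_map S J h s \<otimes>\<^bsub>adic_completion S J\<^esub> completion_map S J h t"
      by (simp add: x(2) y(2) R.residues_of_mult S.residues_of_mult rep xc yc hm hc)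
    show "completion_map S J h (s \<oplus>\<^bsub>adic_completion R I\<^esub> t)
        = completion_map S J h s \<oplus>\<^bsub>adic_completion S J\<^esub> completion_map S J h t"
      by (simp add: x(2) y(2) R.residues_of_add S.residues_of_add rep xc yc ha hc)
  next
    show "completion_map S J h \<one>\<^bsub>adic_completion R I\<^esub> = \<one>\<^bsub>adic_completion S J\<^esub>"
      by (simp add: R.adic_completion_one S.adic_completion_one rep ring_hom_one[OF assms(3)])
  qed
qed

section \<open>The levelwise completion as a simplicial ring\<close>

lemma simplicial_completion_simps [simp]:
  "level (simplicial_completion A) n = adic_completion (level A n) (aug_ideal A n)"
  "face (simplicial_completion A) n i = completion_map (level A n) (aug_ideal A n) (face A n i)"
  "degen (simplicial_completion A) n i = completion_map (level A (Suc n)) (aug_ideal A (Suc n)) (degen A n i)"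
  by (simp_all add: simplicial_completion_def)

context cring_with_ideal
begin

lemma minus_zero: "x \<in> carrier R \<Longrightarrow> x \<ominus> \<zero> = x"
  by (simp add: minus_eq)

lemma residues_of_eq_zero_iff:
  assumes "\<And>m. x m \<in> carrier R"
  shows "residues_of x = \<zero>\<^bsub>adic_completion R I\<^esub> \<longleftrightarrow> (\<forall>m. x m \<in> ideal_power R I m)"
  by (simp add: adic_completion_zero residues_of_eq_iff assms minus_zero)

end

context simplicial_cring
begin

interpretation L: cring "level A l" for l
  by (rule cring_level)

lemma cring_with_aug_ideal: "cring_with_ideal (level A n) (aug_ideal A n)"
  by (intro cring_with_ideal.intro cring_level cring_with_ideal_axioms.intro aug_ideal_ideal)

interpretation C: cring_with_ideal "level A l" "aug_ideal A l" for l
  by (rule cring_with_aug_ideal)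

lemma face_aug_ideal: "i \<le> Suc n \<Longrightarrow> face A n i ` aug_ideal A (Suc n) \<subseteq> aug_ideal A n"
  using simplicial_idealD(2)[OF aug_ideal_simplicial] by blast

lemma degen_aug_ideal: "i \<le> n \<Longrightarrow> degen A n i ` aug_ideal A n \<subseteq> aug_ideal A (Suc n)"
  using simplicial_idealD(3)[OF aug_ideal_simplicial] by blast

lemma face_residues:
  assumes "i \<le> Suc n" "\<And>m. x m \<in> carrier (level A (Suc n))"
  shows "completion_map (level A n) (aug_ideal A n) (face A n i) (C.residues_of (Suc n) x)
    = C.residues_of n (\<lambda>m. face A n i (x m))"
  by (rule completion_map_residues[OF cring_with_aug_ideal cring_with_aug_ideal face_hom[OF assms(1)]
        face_aug_ideal[OF assms(1)] assms(2)])

lemma degen_residues: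
  assumes "i \<le> n" "\<And>m. x m \<in> carrier (level A n)"
  shows "completion_map (level A (Suc n)) (aug_ideal A (Suc n)) (degen A n i) (C.residues_of n x)
    = C.residues_of (Suc n) (\<lambda>m. degen A n i (x m))"
  by (rule completion_map_residues[OF cring_with_aug_ideal cring_with_aug_ideal degen_hom[OF assms(1)]
        degen_aug_ideal[OF assms(1)] assms(2)])

text \<open>Faces and degeneracies act termwise on representatives, so each simplicial identity is
  inherited from \<open>A\<close>.\<close>

lemma simplicial_cring_completion: "simplicial_cring (simplicial_completion A)"
proof (intro simplicial_cring.intro, unfold simplicial_completion_simps)
  fix n i j :: nat and s
  show "cring (adic_completion (level A n) (aug_ideal A n))" by (rule C.adic_completion_cring)
  show "completion_map (level A n) (aug_ideal A n) (face A n i)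
      \<in> ring_hom (adic_completion (level A (Suc n)) (aug_ideal A (Suc n)))
          (adic_completion (level A n) (aug_ideal A n))" if "i \<le> Suc n"
    by (rule completion_map_hom[OF cring_with_aug_ideal cring_with_aug_ideal face_hom[OF that]
          face_aug_ideal[OF that]])
  show "completion_map (level A (Suc n)) (aug_ideal A (Suc n)) (degen A n i)
      \<in> ring_hom (adic_completion (level A n) (aug_ideal A n))
          (adic_completion (level A (Suc n)) (aug_ideal A (Suc n)))" if "i \<le> n"
    by (rule completion_map_hom[OF cring_with_aug_ideal cring_with_aug_ideal degen_hom[OF that]
          degen_aug_ideal[OF that]])
  let ?f = "\<lambda>n i. completion_map (level A n) (aug_ideal A n) (face A n i)"
  let ?d = "\<lambda>n i. completion_map (level A (Suc n)) (aug_ideal A (Suc n)) (degen A n i)"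
  show "?f n i (?f (Suc n) j s) = ?f n (j - 1) (?f (Suc n) i s)"
    if s: "s \<in> carrier (adic_completion (level A (Suc (Suc n))) (aug_ideal A (Suc (Suc n))))"
      and ij: "i < j" "j \<le> Suc (Suc n)"
  proof -
    obtain x where x: "C.adic_cauchy (Suc (Suc n)) x" "s = C.residues_of (Suc (Suc n)) x"
      using s by (rule C.adic_completionE)
    note xc = C.adic_cauchyD[OF x(1)]
    show ?thesis using ij xc by (simp add: x(2) face_residues face_face[OF xc ij])
  qed
  show "?d (Suc n) i (?d n j s) = ?d (Suc n) (Suc j) (?d n i s)"
    if s: "s \<in> carrier (adic_completion (level A n) (aug_ideal A n))" and ij: "i \<le> j" "j \<le> n"
  proof -
    obtain x where x: "C.adic_cauchy n x" "s = C.residues_of n x"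
      using s by (rule C.adic_completionE)
    note xc = C.adic_cauchyD[OF x(1)]
    show ?thesis using ij xc by (simp add: x(2) degen_residues degen_degen[OF xc ij])
  qed
  show "?f (Suc n) i (?d (Suc n) j s) = ?d n (j - 1) (?f n i s)"
    if s: "s \<in> carrier (adic_completion (level A (Suc n)) (aug_ideal A (Suc n)))"
      and ij: "i < j" "j \<le> Suc n"
  proof -
    obtain x where x: "C.adic_cauchy (Suc n) x" "s = C.residues_of (Suc n) x"
      using s by (rule C.adic_completionE)
    note xc = C.adic_cauchyD[OF x(1)]
    show ?thesis using ij xc by (simp add: x(2) face_residues degen_residues face_degen_less[OF xc ij])
  qed
  show "?f n i (?d n j s) = s"
    if s: "s \<in> carrier (adic_completion (level A n) (aug_ideal A n))" and ij: "j \<le> n" "i = j \<or> i = Suc j"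
  proof -
    obtain x where x: "C.adic_cauchy n x" "s = C.residues_of n x"
      using s by (rule C.adic_completionE)
    note xc = C.adic_cauchyD[OF x(1)]
    have "i \<le> Suc n" using ij by auto
    then show ?thesis using ij(1) xc by (simp add: x(2) face_residues degen_residues face_degen_same[OF xc ij])
  qed
  show "?f (Suc n) i (?d (Suc n) j s) = ?d n j (?f n (i - 1) s)"
    if s: "s \<in> carrier (adic_completion (level A (Suc n)) (aug_ideal A (Suc n)))"
      and ij: "Suc j < i" "i \<le> Suc (Suc n)"
  proof -
    obtain x where x: "C.adic_cauchy (Suc n) x" "s = C.residues_of (Suc n) x"
      using s by (rule C.adic_completionE)
    note xc = C.adic_cauchyD[OF x(1)]
    show ?thesis using ij xc by (simp add: x(2) face_residues degen_residues face_degen_greater[OF xc ij])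
  qed
qed

lemma canonical_map_eq: "canonical_map A n x = C.residues_of n (\<lambda>m. x)"
  by (simp add: canonical_map_def C.completion_unit_eq)

lemma canonical_map_simplicial_hom: "canonical_map A \<in> simplicial_hom A (simplicial_completion A)"
proof -
  have "canonical_map A n \<in> ring_hom (level A n) (level (simplicial_completion A) n)" for n
    using C.completion_unit_hom by (simp add: canonical_map_def)
  then show ?thesis
    by (simp add: simplicial_hom_def canonical_map_eq face_residues degen_residues)
qed

text \<open>Representatives of a Moore chain of the completion are Moore chains only approximately:
  the faces of the \<open>m\<close>-th term need only lie in the \<open>m\<close>-th power.\<close>

lemma moore_completion_iff:
  assumes "C.adic_cauchy (Suc n) x"
  shows "C.residues_of (Suc n) x \<in> moore (simplicial_completion A) (Suc n) \<longleftrightarrow>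
    (\<forall>i\<in>{1..Suc n}. \<forall>m. face A n i (x m) \<in> ideal_power (level A n) (aug_ideal A n) m)"
proof -
  note xc = C.adic_cauchyD[OF assms]
  have "completion_map (level A n) (aug_ideal A n) (face A n i) (C.residues_of (Suc n) x)
      = \<zero>\<^bsub>adic_completion (level A n) (aug_ideal A n)\<^esub> \<longleftrightarrow>
      (\<forall>m. face A n i (x m) \<in> ideal_power (level A n) (aug_ideal A n) m)" if "i \<le> Suc n" for i
    using that xc by (simp add: face_residues C.residues_of_eq_zero_iff)
  then show ?thesis using C.residues_of_closed[OF assms] by auto
qed

lemma moore_cycles_completion:
  assumes "C.adic_cauchy (Suc n) x"
    and "C.residues_of (Suc n) x \<in> moore_cycles (simplicial_completion A) (Suc n)" and "i \<le> Suc n"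
  shows "face A n i (x m) \<in> ideal_power (level A n) (aug_ideal A n) m"
proof (cases "i = 0")
  case True
  note xc = C.adic_cauchyD[OF assms(1)]
  have "completion_map (level A n) (aug_ideal A n) (face A n 0) (C.residues_of (Suc n) x)
      = \<zero>\<^bsub>adic_completion (level A n) (aug_ideal A n)\<^esub>"
    using assms(2) by simp
  then show ?thesis using xc by (simp add: True face_residues C.residues_of_eq_zero_iff)
next
  case False
  then show ?thesis
    using moore_completion_iff[OF assms(1)] moore_cycles_moore assms(3)
      simplicial_cring.moore_cycles_moore[OF simplicial_cring_completion assms(2)] by auto
qed

text \<open>The case of \<open>pro_acyclic\<close> in which \<open>N\<close> is the whole ring, the
  unit for products of ideals.\<close>

lemma pro_acyclic_aug_ideal:
  assumes "\<And>l. noetherian_ring (level A l)"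
  shows "\<exists>m'. \<forall>z\<in>moore_cycles A n. z \<in> ideal_power (level A n) (aug_ideal A n) m' \<longrightarrow>
    (\<exists>u\<in>moore A (Suc n). face A n 0 u = z \<and> u \<in> ideal_power (level A (Suc n)) (aug_ideal A (Suc n)) m)"
proof -
  have "simplicial_ideal A (\<lambda>n. carrier (level A n))"
    using simplicial_ideal_power[OF aug_ideal_simplicial, of 0] by (simp add: ideal_power_0)
  from pro_acyclic[OF simplicial_cring_axioms assms aug_ideal_simplicial this aug_ideal_pi0_trivial]
  show ?thesis unfolding L.ideal_prod_one[OF C.power_ideal] .
qed

end

section \<open>Homotopy groups of the completion\<close>

context simplicial_cring
begin

interpretation L: cring "level A l" for l
  by (rule cring_level)

interpretation C: cring_with_ideal "level A l" "aug_ideal A l" for l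
  by (rule cring_with_aug_ideal)

interpretation hat: simplicial_cring "simplicial_completion A"
  by (rule simplicial_cring_completion)

section \<open>Approximation of chains and cycles along powers of the augmentation ideal\<close>

abbreviation aug_power :: "nat \<Rightarrow> nat \<Rightarrow> 'a set"
  where "aug_power n m \<equiv> ideal_power (level A n) (aug_ideal A n) m"

lemma aug_power_minus: "a \<in> aug_power n m \<Longrightarrow> b \<in> aug_power n m \<Longrightarrow> a \<ominus>\<^bsub>level A n\<^esub> b \<in> aug_power n m"
  by (rule L.ideal_minus_closed[OF C.power_ideal])

lemma aug_power_add: "a \<in> aug_power n m \<Longrightarrow> b \<in> aug_power n m \<Longrightarrow> a \<oplus>\<^bsub>level A n\<^esub> b \<in> aug_power n m"
  by (rule additive_subgroup.a_closed[OF C.power_subgroup])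

lemma aug_power_carrier: "a \<in> aug_power n m \<Longrightarrow> a \<in> carrier (level A n)"
  by (rule ideal.Icarr[OF C.power_ideal])

lemma aug_power_antimono: "k \<le> m \<Longrightarrow> a \<in> aug_power n m \<Longrightarrow> a \<in> aug_power n k"
  using L.ideal_power_antimono[OF C.ideal_I] by blast

lemma face_aug_power: "i \<le> Suc n \<Longrightarrow> a \<in> aug_power (Suc n) m \<Longrightarrow> face A n i a \<in> aug_power n m"
  using simplicial_idealD(2)[OF simplicial_ideal_power[OF aug_ideal_simplicial]] .

lemma moore_lift_mod_aug_power:
  assumes "y \<in> carrier (level A (Suc n))"
    and "\<And>i. 1 \<le> i \<Longrightarrow> i \<le> Suc n \<Longrightarrow> face A n i y \<in> aug_power n m"
  obtains q where "q \<in> aug_power (Suc n) m" "y \<ominus>\<^bsub>level A (Suc n)\<^esub> q \<in> moore A (Suc n)"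
proof -
  have "simplicial_stable A (\<lambda>n. aug_power n m)"
    using simplicial_ideal_power[OF aug_ideal_simplicial] by (simp only: simplicial_ideal_def)
  from moore_correction[OF this C.power_subgroup assms(1)] show ?thesis
    using assms(2) that by blast
qed

lemma moore_cycles_minus:
  "a \<in> moore_cycles A n \<Longrightarrow> b \<in> moore_cycles A n \<Longrightarrow> a \<ominus>\<^bsub>level A n\<^esub> b \<in> moore_cycles A n"
  unfolding a_minus_def
  by (intro additive_subgroup.a_closed[OF moore_cycles_add_subgroup]
      additive_subgroup.a_inv_closed[OF moore_cycles_add_subgroup])

lemma moore_cycles_carrier: "a \<in> moore_cycles A n \<Longrightarrow> a \<in> carrier (level A n)"
  by (rule additive_subgroup.a_Hcarr[OF moore_cycles_add_subgroup])

text \<open>A bounding chain in the completion is truncated at a stage \<open>m\<close> so deep that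
  cycles in \<open>I^m\<close> bound in \<open>A\<close>. The truncation bounds \<open>z\<close> up
  to such a cycle, which bounds as well.\<close>

lemma homotopy_completion_inj:
  assumes noeth: "\<And>l. noetherian_ring (level A l)"
    and z: "z \<in> moore_cycles A n"
    and b: "canonical_map A n z \<in> moore_boundaries (simplicial_completion A) n"
  shows "z \<in> moore_boundaries A n"
proof -
  obtain s where s: "s \<in> moore (simplicial_completion A) (Suc n)"
    "canonical_map A n z = face (simplicial_completion A) n 0 s"
    using b by (auto simp only: moore_boundaries_def)
  have "s \<in> carrier (adic_completion (level A (Suc n)) (aug_ideal A (Suc n)))"
    using hat.moore_carrier[OF s(1)] by simp
  then obtain x where x: "C.adic_cauchy (Suc n) x" "s = C.residues_of (Suc n) x"
    by (rule C.adic_completionE)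
  note xc = C.adic_cauchyD[OF x(1)]
  have zc: "z \<in> carrier (level A n)" by (rule moore_cycles_carrier[OF z])
  \<comment> \<open>Target exponent 0 puts no condition on the bounding chain, the zeroth power
    being the whole ring.\<close>
  obtain m where m: "\<And>t. t \<in> moore_cycles A n \<Longrightarrow> t \<in> aug_power n m \<Longrightarrow> \<exists>u\<in>moore A (Suc n). face A n 0 u = t"
    using pro_acyclic_aug_ideal[OF noeth, of n 0] by blast
  have "face A n i (x m) \<in> aug_power n m" if "1 \<le> i" "i \<le> Suc n" for i
    using s(1) moore_completion_iff[OF x(1)] that unfolding x(2) by (meson atLeastAtMost_iff)
  then obtain q where q: "q \<in> aug_power (Suc n) m" "x m \<ominus>\<^bsub>level A (Suc n)\<^esub> q \<in> moore A (Suc n)"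
    by (rule moore_lift_mod_aug_power[OF xc])
  define w where "w = x m \<ominus>\<^bsub>level A (Suc n)\<^esub> q"
  have w: "w \<in> moore A (Suc n)" "w \<in> carrier (level A (Suc n))"
    using q(2) moore_carrier[OF q(2)] by (simp_all only: w_def)
  have qc: "q \<in> carrier (level A (Suc n))" by (rule aug_power_carrier[OF q(1)])
  have fc: "face A n 0 (x m) \<in> carrier (level A n)" "face A n 0 q \<in> carrier (level A n)"
    using xc qc by simp_all
  define t where "t = z \<ominus>\<^bsub>level A n\<^esub> face A n 0 w"
  have "C.residues_of n (\<lambda>m. z) = C.residues_of n (\<lambda>m. face A n 0 (x m))"
    using s(2) xc by (simp add: canonical_map_eq x(2) face_residues)
  then have "z \<ominus>\<^bsub>level A n\<^esub> face A n 0 (x m) \<in> aug_power n m"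
    using C.residues_of_eq_iff[of "\<lambda>m. z" n "\<lambda>m. face A n 0 (x m)"] zc xc by simp
  \<comment> \<open>The error \<open>z - d_0 w\<close> has two parts in \<open>I^m\<close>: the
    truncation error \<open>z - d_0 (x m)\<close> and the term \<open>d_0 q\<close> from normalising
    \<open>x m\<close>.\<close>
  then have "(z \<ominus>\<^bsub>level A n\<^esub> face A n 0 (x m)) \<oplus>\<^bsub>level A n\<^esub> face A n 0 q \<in> aug_power n m"
    using face_aug_power[OF _ q(1), of 0] by (intro aug_power_add) simp_all
  also have "(z \<ominus>\<^bsub>level A n\<^esub> face A n 0 (x m)) \<oplus>\<^bsub>level A n\<^esub> face A n 0 q
      = z \<ominus>\<^bsub>level A n\<^esub> (face A n 0 (x m) \<ominus>\<^bsub>level A n\<^esub> face A n 0 q)"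
    using zc fc by algebra
  also have "\<dots> = t" unfolding t_def w_def using xc qc by (simp add: face_minus)
  finally have "t \<in> aug_power n m" .
  moreover have "t \<in> moore_cycles A n"
    unfolding t_def by (intro moore_cycles_minus z moore_face_cycle w(1))
  ultimately obtain u where u: "u \<in> moore A (Suc n)" "face A n 0 u = t" using m by blast
  have wu: "w \<oplus>\<^bsub>level A (Suc n)\<^esub> u \<in> moore A (Suc n)"
    by (rule additive_subgroup.a_closed[OF moore_add_subgroup w(1) u(1)])
  have fw: "face A n 0 w \<in> carrier (level A n)" using w(2) by simp
  have "face A n 0 (w \<oplus>\<^bsub>level A (Suc n)\<^esub> u) = face A n 0 w \<oplus>\<^bsub>level A n\<^esub> t"
    using face_add[OF _ w(2) moore_carrier[OF u(1)], of 0] u(2) by simp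
  also have "\<dots> = z" unfolding t_def using zc fw by algebra
  finally show ?thesis using wu unfolding moore_boundaries_def by blast
qed

text \<open>A deep term of the sequence is normalised to a Moore chain \<open>w\<close> with small
  boundary. By pro-vanishing that boundary also bounds a small chain \<open>u\<close>, and
  \<open>w - u\<close> is a true cycle close to the given one.\<close>

lemma cycle_approximation:
  assumes noeth: "\<And>l. noetherian_ring (level A l)"
    and x: "C.adic_cauchy n x" "C.residues_of n x \<in> moore_cycles (simplicial_completion A) n"
  shows "\<exists>c\<in>moore_cycles A n. c \<ominus>\<^bsub>level A n\<^esub> x m \<in> aug_power n m"
proof (cases n)
  case 0
  have "x m \<in> carrier (level A 0)" using C.adic_cauchyD[OF x(1)] 0 by simp
  then show ?thesis
    using additive_subgroup.zero_closed[OF C.power_subgroup, of 0 m]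
    by (intro bexI[of _ "x m"]) (simp_all add: 0 C.minus_self)
next
  case (Suc k)
  note x' = x[unfolded Suc]
  note xc = C.adic_cauchyD[OF x'(1)]
  obtain m' where m': "\<And>t. t \<in> moore_cycles A k \<Longrightarrow> t \<in> aug_power k m' \<Longrightarrow>
      \<exists>u\<in>moore A (Suc k). face A k 0 u = t \<and> u \<in> aug_power (Suc k) m"
    using pro_acyclic_aug_ideal[OF noeth, of k m] by blast
  \<comment> \<open>The bound \<open>m\<close> keeps \<open>x M\<close> close to \<open>x m\<close>,
    and \<open>m'\<close> makes the boundary of \<open>w\<close> deep enough for
    pro-vanishing.\<close>
  define M where "M = max m m'"
  have fx: "face A k i (x M) \<in> aug_power k M" if "i \<le> Suc k" for i
    by (rule moore_cycles_completion[OF x' that])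
  then obtain q where q: "q \<in> aug_power (Suc k) M" "x M \<ominus>\<^bsub>level A (Suc k)\<^esub> q \<in> moore A (Suc k)"
    using moore_lift_mod_aug_power[OF xc] by blast
  define w where "w = x M \<ominus>\<^bsub>level A (Suc k)\<^esub> q"
  have w: "w \<in> moore A (Suc k)" "w \<in> carrier (level A (Suc k))"
    using q(2) moore_carrier[OF q(2)] by (simp_all only: w_def)
  have qc: "q \<in> carrier (level A (Suc k))" by (rule aug_power_carrier[OF q(1)])
  have "face A k 0 w = face A k 0 (x M) \<ominus>\<^bsub>level A k\<^esub> face A k 0 q"
    unfolding w_def using xc qc by (intro face_minus) simp_all
  also have "\<dots> \<in> aug_power k M"
    using fx[of 0] face_aug_power[OF _ q(1), of 0] by (intro aug_power_minus) simp_all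
  finally have "face A k 0 w \<in> aug_power k m'" by (rule aug_power_antimono[rotated]) (simp add: M_def)
  then obtain u where u: "u \<in> moore A (Suc k)" "face A k 0 u = face A k 0 w" "u \<in> aug_power (Suc k) m"
    using m'[OF moore_face_cycle[OF w(1)]] by blast
  have uc: "u \<in> carrier (level A (Suc k))" by (rule moore_carrier[OF u(1)])
  define c where "c = w \<ominus>\<^bsub>level A (Suc k)\<^esub> u"
  have "face A k 0 c = \<zero>\<^bsub>level A k\<^esub>"
    unfolding c_def using w(2) uc by (simp add: face_minus u(2) C.minus_self)
  then have "c \<in> moore_cycles A (Suc k)"
    using moore_minus[OF w(1) u(1)] unfolding moore_cycles.simps c_def by blast
  moreover have "c \<ominus>\<^bsub>level A (Suc k)\<^esub> x m \<in> aug_power (Suc k) m"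
  proof -
    have "(x M \<ominus>\<^bsub>level A (Suc k)\<^esub> x m) \<ominus>\<^bsub>level A (Suc k)\<^esub> (q \<oplus>\<^bsub>level A (Suc k)\<^esub> u) \<in> aug_power (Suc k) m"
      by (rule aug_power_minus[OF C.adic_cauchy_diff[OF x'(1)]
            aug_power_add[OF aug_power_antimono[OF _ q(1)] u(3)]]) (simp_all add: M_def)
    also have "(x M \<ominus>\<^bsub>level A (Suc k)\<^esub> x m) \<ominus>\<^bsub>level A (Suc k)\<^esub> (q \<oplus>\<^bsub>level A (Suc k)\<^esub> u)
        = c \<ominus>\<^bsub>level A (Suc k)\<^esub> x m"
      unfolding c_def w_def using xc[of M] xc[of m] qc uc by algebra
    finally show ?thesis .
  qed
  ultimately show ?thesis unfolding Suc by blast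
qed

text \<open>Cycles of \<open>A\<close> approximating \<open>s\<close> differ successively by small
  cycles, which bound small chains. These chains sum to a chain of the completion whose boundary is
  \<open>s\<close> minus the image of the first approximation.\<close>

lemma homotopy_completion_surj:
  assumes noeth: "\<And>l. noetherian_ring (level A l)"
    and s: "s \<in> moore_cycles (simplicial_completion A) n"
  shows "\<exists>c\<in>moore_cycles A n. \<exists>b\<in>moore_boundaries (simplicial_completion A) n.
    s = b \<oplus>\<^bsub>level (simplicial_completion A) n\<^esub> canonical_map A n c"
proof -
  have "s \<in> carrier (adic_completion (level A n) (aug_ideal A n))"
    using hat.moore_carrier[OF hat.moore_cycles_moore[OF s]] by simp
  then obtain x where x: "C.adic_cauchy n x" "s = C.residues_of n x"
    by (rule C.adic_completionE)
  note xc = C.adic_cauchyD[OF x(1)]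
  have "\<forall>k. \<exists>g. \<forall>t\<in>moore_cycles A n. t \<in> aug_power n g \<longrightarrow>
      (\<exists>u\<in>moore A (Suc n). face A n 0 u = t \<and> u \<in> aug_power (Suc n) k)"
    using pro_acyclic_aug_ideal[OF noeth] by blast
  then obtain g where g: "\<And>k t. t \<in> moore_cycles A n \<Longrightarrow> t \<in> aug_power n (g k) \<Longrightarrow>
      \<exists>u\<in>moore A (Suc n). face A n 0 u = t \<and> u \<in> aug_power (Suc n) k"
    by metis
  \<comment> \<open>Summing all \<open>g j\<close> up to \<open>k\<close> and adding
    \<open>k\<close> gives a monotone sequence that dominates both \<open>g k\<close> and
    \<open>k\<close>.\<close>
  define M where "M k = (\<Sum>j\<le>k. g j) + k" for k
  have M: "g k \<le> M k" "k \<le> M k" "M k \<le> M (Suc k)" for k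
    by (auto simp: M_def intro: trans_le_add1 member_le_sum)
  have "\<forall>k. \<exists>c\<in>moore_cycles A n. c \<ominus>\<^bsub>level A n\<^esub> x (M k) \<in> aug_power n (M k)"
    using cycle_approximation[OF noeth x(1)] s unfolding x(2) by blast
  then obtain c where c: "\<And>k. c k \<in> moore_cycles A n"
    "\<And>k. c k \<ominus>\<^bsub>level A n\<^esub> x (M k) \<in> aug_power n (M k)"
    by metis
  have cc: "c k \<in> carrier (level A n)" for k by (rule moore_cycles_carrier[OF c(1)])
  have "c (Suc k) \<ominus>\<^bsub>level A n\<^esub> c k \<in> aug_power n (M k)" for k
  proof -
    \<comment> \<open>Two consecutive cycles are compared through \<open>x (M (Suc k))\<close> and
      \<open>x (M k)\<close>.\<close>
    have "((c (Suc k) \<ominus>\<^bsub>level A n\<^esub> x (M (Suc k))) \<oplus>\<^bsub>level A n\<^esub> (x (M (Suc k)) \<ominus>\<^bsub>level A n\<^esub> x (M k)))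
        \<ominus>\<^bsub>level A n\<^esub> (c k \<ominus>\<^bsub>level A n\<^esub> x (M k)) \<in> aug_power n (M k)"
      by (rule aug_power_minus[OF aug_power_add[OF aug_power_antimono[OF M(3) c(2)]
              C.adic_cauchy_diff[OF x(1) M(3)]] c(2)])
    also have "((c (Suc k) \<ominus>\<^bsub>level A n\<^esub> x (M (Suc k))) \<oplus>\<^bsub>level A n\<^esub> (x (M (Suc k)) \<ominus>\<^bsub>level A n\<^esub> x (M k)))
        \<ominus>\<^bsub>level A n\<^esub> (c k \<ominus>\<^bsub>level A n\<^esub> x (M k)) = c (Suc k) \<ominus>\<^bsub>level A n\<^esub> c k"
      using cc[of k] cc[of "Suc k"] xc[of "M k"] xc[of "M (Suc k)"] by algebra
    finally show ?thesis .
  qed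
  then have "\<exists>e\<in>moore A (Suc n). face A n 0 e = c (Suc k) \<ominus>\<^bsub>level A n\<^esub> c k \<and> e \<in> aug_power (Suc n) k" for k
    by (intro g moore_cycles_minus c(1) aug_power_antimono[OF M(1)])
  then obtain e where e: "\<And>k. e k \<in> moore A (Suc n)"
    "\<And>k. face A n 0 (e k) = c (Suc k) \<ominus>\<^bsub>level A n\<^esub> c k" "\<And>k. e k \<in> aug_power (Suc n) k"
    by metis
  have ec: "e k \<in> carrier (level A (Suc n))" for k by (rule moore_carrier[OF e(1)])
  \<comment> \<open>The partial sums of the bounding chains; they are Cauchy because
    \<open>e k\<close> lies in the \<open>k\<close>-th power.\<close>
  define E where "E = rec_nat \<zero>\<^bsub>level A (Suc n)\<^esub> (\<lambda>k a. a \<oplus>\<^bsub>level A (Suc n)\<^esub> e k)"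
  have E_simps: "E 0 = \<zero>\<^bsub>level A (Suc n)\<^esub>" "E (Suc k) = E k \<oplus>\<^bsub>level A (Suc n)\<^esub> e k" for k
    by (simp_all add: E_def)
  have Em: "E k \<in> moore A (Suc n)" for k
  proof (induction k)
    case 0
    show ?case unfolding E_simps by (rule additive_subgroup.zero_closed[OF moore_add_subgroup])
  next
    case (Suc k)
    show ?case unfolding E_simps by (rule additive_subgroup.a_closed[OF moore_add_subgroup Suc e(1)])
  qed
  have Ec: "E k \<in> carrier (level A (Suc n))" for k by (rule moore_carrier[OF Em])
  have "E (Suc k) \<ominus>\<^bsub>level A (Suc n)\<^esub> E k = e k" for k
    unfolding E_simps by (rule L.add_minus_cancel_left[OF Ec ec])
  then have E: "C.adic_cauchy (Suc n) E" unfolding C.adic_cauchy_def using Ec e(3) by simp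
  have fE: "face A n 0 (E k) = c k \<ominus>\<^bsub>level A n\<^esub> c 0" for k
  proof (induction k)
    case 0
    show ?case unfolding E_simps using C.minus_self[OF cc] by simp
  next
    case (Suc k)
    \<comment> \<open>The boundaries telescope.\<close>
    have "face A n 0 (E (Suc k)) = (c k \<ominus>\<^bsub>level A n\<^esub> c 0) \<oplus>\<^bsub>level A n\<^esub> (c (Suc k) \<ominus>\<^bsub>level A n\<^esub> c k)"
      unfolding E_simps using Suc e(2) by (simp add: face_add Ec ec)
    also have "\<dots> = c (Suc k) \<ominus>\<^bsub>level A n\<^esub> c 0" by (rule L.minus_telescope[OF cc cc cc])
    finally show ?case .
  qed
  have "C.residues_of (Suc n) E \<in> moore (simplicial_completion A) (Suc n)"
    unfolding moore_completion_iff[OF E]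
    using moore_SucD(2)[OF Em] additive_subgroup.zero_closed[OF C.power_subgroup] by simp
  then have bd: "C.residues_of n (\<lambda>m. face A n 0 (E m)) \<in> moore_boundaries (simplicial_completion A) n"
    unfolding moore_boundaries_def using Ec
    by (intro image_eqI[of _ _ "C.residues_of (Suc n) E"]) (simp_all add: face_residues del: moore.simps)
  \<comment> \<open>The approximating cycles are another sequence of representatives of
    \<open>s\<close>.\<close>
  have "x m \<ominus>\<^bsub>level A n\<^esub> c m \<in> aug_power n m" for m
  proof -
    have "\<zero>\<^bsub>level A n\<^esub> \<ominus>\<^bsub>level A n\<^esub> ((c m \<ominus>\<^bsub>level A n\<^esub> x (M m)) \<oplus>\<^bsub>level A n\<^esub> (x (M m) \<ominus>\<^bsub>level A n\<^esub> x m)) \<in> aug_power n m"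
      by (rule aug_power_minus[OF additive_subgroup.zero_closed[OF C.power_subgroup]
            aug_power_add[OF aug_power_antimono[OF M(2) c(2)] C.adic_cauchy_diff[OF x(1) M(2)]]])
    also have "\<zero>\<^bsub>level A n\<^esub> \<ominus>\<^bsub>level A n\<^esub> ((c m \<ominus>\<^bsub>level A n\<^esub> x (M m)) \<oplus>\<^bsub>level A n\<^esub> (x (M m) \<ominus>\<^bsub>level A n\<^esub> x m))
        = x m \<ominus>\<^bsub>level A n\<^esub> c m"
      using cc[of m] xc[of m] xc[of "M m"] by algebra
    finally show ?thesis .
  qed
  then have "s = C.residues_of n c"
    unfolding x(2) using C.residues_of_eq_iff[of x n c] xc cc by simp
  \<comment> \<open>The telescoped identity splits \<open>s\<close> into the boundary of the class
    of \<open>E\<close> and the constant sequence \<open>c 0\<close>.\<close>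
  also have "c = (\<lambda>m. face A n 0 (E m) \<oplus>\<^bsub>level A n\<^esub> c 0)"
  proof
    fix m
    show "c m = face A n 0 (E m) \<oplus>\<^bsub>level A n\<^esub> c 0"
      unfolding fE using cc by (simp add: a_minus_def L.a_assoc L.l_neg)
  qed
  also have "C.residues_of n (\<lambda>m. face A n 0 (E m) \<oplus>\<^bsub>level A n\<^esub> c 0)
      = C.residues_of n (\<lambda>m. face A n 0 (E m)) \<oplus>\<^bsub>level (simplicial_completion A) n\<^esub> canonical_map A n (c 0)"
    using cc Ec by (simp add: canonical_map_eq C.residues_of_add)
  finally show ?thesis using bd c(1)[of 0] by blast
qed

section \<open>Homotopy groups as quotients and the comparison isomorphism\<close>

lemma homotopy_group_comm_group:
  "comm_group ((add_monoid (level A n))\<lparr>carrier := moore_cycles A n\<rparr>)"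
  "subgroup (moore_boundaries A n) ((add_monoid (level A n))\<lparr>carrier := moore_cycles A n\<rparr>)"
proof -
  let ?Z = "(add_monoid (level A n))\<lparr>carrier := moore_cycles A n\<rparr>"
  have Z: "subgroup (moore_cycles A n) (add_monoid (level A n))"
    by (rule additive_subgroup.a_subgroup[OF moore_cycles_add_subgroup])
  have "group ?Z" by (rule subgroup.subgroup_is_group[OF Z L.a_group])
  then show "comm_group ?Z"
    by (rule group.group_comm_groupI) (use moore_cycles_carrier in \<open>auto intro: L.a_comm\<close>)
  show "subgroup (moore_boundaries A n) ?Z"
    by (rule group.subgroup_incl[OF L.a_group _ Z moore_boundaries_subset_cycles])
      (rule additive_subgroup.a_subgroup[OF moore_boundaries_add_subgroup])
qed

lemma simplicial_hom_moore:
  assumes B: "simplicial_cring B" and f: "f \<in> simplicial_hom A B"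
  shows "x \<in> moore A n \<Longrightarrow> f n x \<in> moore B n"
    and "x \<in> moore_cycles A n \<Longrightarrow> f n x \<in> moore_cycles B n"
    and "f n ` moore_boundaries A n \<subseteq> moore_boundaries B n"
proof -
  interpret B: simplicial_cring B by fact
  have hom: "f n \<in> ring_hom (level A n) (level B n)" for n using f by (simp add: simplicial_hom_def)
  have face: "face B n i (f (Suc n) x) = f n (face A n i x)"
    if "i \<le> Suc n" "x \<in> carrier (level A (Suc n))" for n i x
    using f that by (simp add: simplicial_hom_def)
  have zero: "f n \<zero>\<^bsub>level A n\<^esub> = \<zero>\<^bsub>level B n\<^esub>" for n
    by (rule ring_hom_zero[OF hom L.ring_axioms cring.axioms(1)[OF B.cring_level]])
  note closed = ring_hom_closed[OF hom]
  show moore: "x \<in> moore A n \<Longrightarrow> f n x \<in> moore B n" for x n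
    by (cases n) (auto simp: face zero closed)
  show "x \<in> moore_cycles A n \<Longrightarrow> f n x \<in> moore_cycles B n"
    by (cases n) (auto simp: face zero closed)
  show "f n ` moore_boundaries A n \<subseteq> moore_boundaries B n"
    using moore[of _ "Suc n"] moore_carrier[of _ "Suc n"] face[of 0 n]
    unfolding moore_boundaries_def by (auto simp del: moore.simps intro!: image_eqI)
qed

lemma weak_equivalence_completion:
  assumes noeth: "\<And>l. noetherian_ring (level A l)"
  shows "weak_equivalence A (simplicial_completion A) (canonical_map A)"
  unfolding weak_equivalence_def
proof (intro conjI allI)
  show "simplicial_cring A" by (rule simplicial_cring_axioms)
  show "simplicial_cring (simplicial_completion A)" by (rule simplicial_cring_completion)
  show f: "canonical_map A \<in> simplicial_hom A (simplicial_completion A)"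
    by (rule canonical_map_simplicial_hom)
  fix n
  let ?B = "simplicial_completion A"
  let ?G = "(add_monoid (level A n))\<lparr>carrier := moore_cycles A n\<rparr>"
  let ?H = "(add_monoid (level ?B n))\<lparr>carrier := moore_cycles ?B n\<rparr>"
  note f_moore = simplicial_hom_moore[OF simplicial_cring_completion f]
  have fr: "canonical_map A n \<in> ring_hom (level A n) (level ?B n)"
    using f by (simp only: simplicial_hom_def mem_Collect_eq)
  have hom: "canonical_map A n \<in> hom ?G ?H"
    by (rule homI) (use f_moore(2) ring_hom_add[OF fr] moore_cycles_carrier in auto)
  have "(\<lambda>U. moore_boundaries ?B n <#>\<^bsub>?H\<^esub> (canonical_map A n ` U))
      \<in> iso (?G Mod moore_boundaries A n) (?H Mod moore_boundaries ?B n)"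
    by (rule FactGroup_map_iso[OF homotopy_group_comm_group(1)
          simplicial_cring.homotopy_group_comm_group(1)[OF simplicial_cring_completion]
          homotopy_group_comm_group(2)
          simplicial_cring.homotopy_group_comm_group(2)[OF simplicial_cring_completion] hom f_moore(3)])
      (use homotopy_completion_inj[OF noeth] homotopy_completion_surj[OF noeth] in auto)
  \<comment> \<open>Restricting the carrier to the cycles leaves the operation unchanged, so the set
    product in \<open>?H\<close> is the set sum in the full level used by
    \<open>homotopy_map\<close>.\<close>
  moreover have "(\<lambda>U. moore_boundaries ?B n <#>\<^bsub>?H\<^esub> (canonical_map A n ` U))
      = homotopy_map A ?B (canonical_map A) n"
    by (simp add: fun_eq_iff homotopy_map_def set_add_def set_mult_def)
  ultimately show "homotopy_map A ?B (canonical_map A) n \<in> iso (homotopy_group A n) (homotopy_group ?B n)"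
    unfolding homotopy_group_def by simp
qed

end

theorem proposition6p6:
  fixes A :: "'a simplicial"
  assumes "simplicial_cring A"
    and "\<And>n. noetherian_ring (level A n)"
  shows "weak_equivalence A (simplicial_completion A) (canonical_map A)"
  by (rule simplicial_cring.weak_equivalence_completion[OF assms])

end
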